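(* Let $G$ be a finite group of odd order. If $d(G) > 35/243$, then $G$ is either supersolvable or isoclinic to $(C_5\times C_5)\rtimes C_3$.
   Context: For a finite group $G$, $d(G) := \frac{1}{|G|^2}\,|\{(x,y)\in G\times G \mid xy=yx\}|$ is the commuting probability of $G$; equivalently $d(G)=k(G)/|G|$, where $k(G)$ is the number of conjugacy classes of $G$. $C_n$ denotes the cyclic group of order $n$, $\mathbf{Z}(G)$ the center of $G$, and $G'$ the commutator (derived) subgroup of $G$. The group $(C_5\times C_5)\rtimes C_3$ is the non-supersolvable group of order 75, i.e. the semidirect product with $C_3$ acting nontrivially on $C_5\times C_5$ (unique up to isomorphism). Two groups $G$ and $H$ are isoclinic if there are isomorphisms $\varphi: G/\mathbf{Z}(G)\to H/\mathbf{Z}(H)$ and $\phi: G'\to H'$ such that whenever $\varphi(g_1\mathbf{Z}(G))=h_1\mathbf{Z}(H)$ and $\varphi(g_2\mathbf{Z}(G))=h_2\mathbf{Z}(H)$, one has $\phi([g_1,g_2])=[h_1,h_2]$. *)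

theory Defs
  imports Complex_Main "HOL-Algebra.Elementary_Groups" "HOL-Algebra.Bij"
begin

definition commuting_probability :: "('a, 'b) monoid_scheme \<Rightarrow> real" where
  "commuting_probability G =
     real (card {(x, y). x \<in> carrier G \<and> y \<in> carrier G \<and> x \<otimes>\<^bsub>G\<^esub> y = y \<otimes>\<^bsub>G\<^esub> x})
       / real (order G) ^ 2"

definition group_center :: "('a, 'b) monoid_scheme \<Rightarrow> 'a set" where
  "group_center G = {z \<in> carrier G. \<forall>x \<in> carrier G. z \<otimes>\<^bsub>G\<^esub> x = x \<otimes>\<^bsub>G\<^esub> z}"

definition derived_group :: "('a, 'b) monoid_scheme \<Rightarrow> ('a, 'b) monoid_scheme" where
  "derived_group G = G\<lparr>carrier := derived G (carrier G)\<rparr>"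

text \<open>The convention is that of \<^const>\<open>derived\<close>. Replacing it by
  \<open>inv x \<otimes> inv y \<otimes> x \<otimes> y\<close> yields the same notion of isoclinism, since this is the
  commutator below of \<open>inv x\<close> and \<open>inv y\<close>.\<close>

definition commutator :: "('a, 'b) monoid_scheme \<Rightarrow> 'a \<Rightarrow> 'a \<Rightarrow> 'a" where
  "commutator G x y = x \<otimes>\<^bsub>G\<^esub> y \<otimes>\<^bsub>G\<^esub> inv\<^bsub>G\<^esub> x \<otimes>\<^bsub>G\<^esub> inv\<^bsub>G\<^esub> y"

definition isoclinic :: "('a, 'b) monoid_scheme \<Rightarrow> ('c, 'd) monoid_scheme \<Rightarrow> bool" where
  "isoclinic G H \<longleftrightarrow>
     (\<exists>\<phi> \<in> iso (G Mod group_center G) (H Mod group_center H).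
      \<exists>\<psi> \<in> iso (derived_group G) (derived_group H).
        \<forall>g1 \<in> carrier G. \<forall>g2 \<in> carrier G. \<forall>h1 \<in> carrier H. \<forall>h2 \<in> carrier H.
          \<phi> (group_center G #>\<^bsub>G\<^esub> g1) = group_center H #>\<^bsub>H\<^esub> h1 \<and>
          \<phi> (group_center G #>\<^bsub>G\<^esub> g2) = group_center H #>\<^bsub>H\<^esub> h2 \<longrightarrow>
          \<psi> (commutator G g1 g2) = commutator H h1 h2)"

text \<open>Every term of the series is required to be normal in the whole group, not merely in
  the next term.\<close>

definition supersolvable :: "('a, 'b) monoid_scheme \<Rightarrow> bool" where
  "supersolvable G \<longleftrightarrow>
     (\<exists>(n :: nat) N. N 0 = {\<one>\<^bsub>G\<^esub>} \<and> N n = carrier G \<and> (\<forall>i \<le> n. N i \<lhd> G) \<and>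
        (\<forall>i < n. N i \<subseteq> N (Suc i) \<and> cyclic_group (G\<lparr>carrier := N (Suc i)\<rparr> Mod N i)))"

text \<open>The external semidirect product of \<open>N\<close> by \<open>H\<close>, meaningful when
  \<open>\<alpha> \<in> hom H (AutoGroup N)\<close>.\<close>

definition semidirect_product ::
    "('a, 'b) monoid_scheme \<Rightarrow> ('c, 'd) monoid_scheme \<Rightarrow> ('c \<Rightarrow> 'a \<Rightarrow> 'a) \<Rightarrow> ('a \<times> 'c) monoid" where
  "semidirect_product N H \<alpha> =
     \<lparr>carrier = carrier N \<times> carrier H,
      monoid.mult = (\<lambda>(n1, h1) (n2, h2). (n1 \<otimes>\<^bsub>N\<^esub> \<alpha> h1 n2, h1 \<otimes>\<^bsub>H\<^esub> h2)),
      one = (\<one>\<^bsub>N\<^esub>, \<one>\<^bsub>H\<^esub>)\<rparr>"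

lemma auto_group_apply:
  assumes N: "group N" and \<alpha>: "\<alpha> \<in> hom H (AutoGroup N)" and H: "group H"
  shows "h \<in> carrier H \<Longrightarrow> \<alpha> h \<in> hom N N"
    and "h \<in> carrier H \<Longrightarrow> bij_betw (\<alpha> h) (carrier N) (carrier N)"
    and "\<lbrakk>h \<in> carrier H; k \<in> carrier H; x \<in> carrier N\<rbrakk> \<Longrightarrow> \<alpha> (h \<otimes>\<^bsub>H\<^esub> k) x = \<alpha> h (\<alpha> k x)"
    and "x \<in> carrier N \<Longrightarrow> \<alpha> \<one>\<^bsub>H\<^esub> x = x"
proof -
  have A: "\<alpha> h \<in> auto N" if "h \<in> carrier H" for h
    using hom_in_carrier[OF \<alpha> that] by (simp add: AutoGroup_def)
  show 1: "\<alpha> h \<in> hom N N" if "h \<in> carrier H" for h using A[OF that] by (simp add: auto_def)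
  show B: "bij_betw (\<alpha> h) (carrier N) (carrier N)" if "h \<in> carrier H" for h
    using A[OF that] by (simp add: auto_def Bij_def)
  show C: "\<alpha> (h \<otimes>\<^bsub>H\<^esub> k) x = \<alpha> h (\<alpha> k x)"
    if "h \<in> carrier H" "k \<in> carrier H" "x \<in> carrier N" for h k x
    using hom_mult[OF \<alpha> that(1,2)] A[OF that(1)] A[OF that(2)] that(3)
    by (simp add: AutoGroup_def BijGroup_def auto_def compose_def)
  show "\<alpha> \<one>\<^bsub>H\<^esub> x = x" if x: "x \<in> carrier N" for x
  proof -
    interpret H: group H by fact
    have y: "\<alpha> \<one>\<^bsub>H\<^esub> x \<in> carrier N" using B[OF H.one_closed] x by (auto simp: bij_betw_def)
    have "\<alpha> \<one>\<^bsub>H\<^esub> (\<alpha> \<one>\<^bsub>H\<^esub> x) = \<alpha> \<one>\<^bsub>H\<^esub> x" using C[of "\<one>\<^bsub>H\<^esub>" "\<one>\<^bsub>H\<^esub>" x] x by simp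
    then show ?thesis using B[OF H.one_closed] x y by (auto simp: bij_betw_def dest: inj_onD)
  qed
qed

lemma group_semidirect_product:
  assumes N: "group N" and H: "group H" and \<alpha>: "\<alpha> \<in> hom H (AutoGroup N)"
  shows "group (semidirect_product N H \<alpha>)"
proof -
  interpret N: group N by fact
  interpret H: group H by fact
  note a = auto_group_apply[OF N \<alpha> H]
  have cl: "\<alpha> h x \<in> carrier N" if "h \<in> carrier H" "x \<in> carrier N" for h x
    using a(1)[OF that(1)] that(2) by (rule hom_in_carrier)
  have mu: "\<alpha> h (x \<otimes>\<^bsub>N\<^esub> y) = \<alpha> h x \<otimes>\<^bsub>N\<^esub> \<alpha> h y"
    if "h \<in> carrier H" "x \<in> carrier N" "y \<in> carrier N" for h x y
    using a(1)[OF that(1)] that(2,3) by (rule hom_mult)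
  show ?thesis
  proof (rule groupI, goal_cases)
    case (5 x)
    then obtain n h where x: "x = (n, h)" "n \<in> carrier N" "h \<in> carrier H"
      by (auto simp: semidirect_product_def)
    have "\<alpha> (inv\<^bsub>H\<^esub> h) (inv\<^bsub>N\<^esub> n) \<otimes>\<^bsub>N\<^esub> \<alpha> (inv\<^bsub>H\<^esub> h) n = \<alpha> (inv\<^bsub>H\<^esub> h) \<one>\<^bsub>N\<^esub>"
      using x by (simp flip: mu)
    also have "\<dots> = \<one>\<^bsub>N\<^esub>" using hom_one[OF a(1) N N] x by simp
    finally show ?case using x
      by (intro bexI[of _ "(\<alpha> (inv\<^bsub>H\<^esub> h) (inv\<^bsub>N\<^esub> n), inv\<^bsub>H\<^esub> h)"])
         (auto simp: semidirect_product_def cl)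
  qed (auto simp: semidirect_product_def cl a mu N.m_assoc H.m_assoc)
qed

abbreviation C5_C5 :: "(int \<times> int) monoid" where
  "C5_C5 \<equiv> integer_mod_group 5 \<times>\<times> integer_mod_group 5"

text \<open>Multiplication by the companion matrix of \<open>X\<^sup>2 + X + 1\<close> on column vectors modulo 5;
  it has order 3. Since that polynomial has no root modulo 5, no line of \<open>C5_C5\<close> is
  invariant, so \<open>G75\<close> below is not supersolvable. All nontrivial actions of the cyclic group of
  order 3 on \<open>C5_C5\<close> give isomorphic semidirect products.\<close>

definition rot5 :: "int \<times> int \<Rightarrow> int \<times> int" where
  "rot5 = (\<lambda>(a, b). ((- b) mod 5, (a - b) mod 5))"

definition C3_action :: "int \<Rightarrow> int \<times> int \<Rightarrow> int \<times> int" where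
  "C3_action k = restrict (rot5 ^^ nat k) (carrier C5_C5)"

definition G75 :: "((int \<times> int) \<times> int) monoid" where
  "G75 = semidirect_product C5_C5 (integer_mod_group 3) C3_action"

lemma carrier_C5_C5: "carrier C5_C5 = {0..<5} \<times> {0..<5}"
  by (simp add: DirProd_def carrier_integer_mod_group)

lemma group_C5_C5: "group C5_C5"
  by (intro DirProd_group) simp_all

lemma rot5_cube: "v \<in> carrier C5_C5 \<Longrightarrow> rot5 (rot5 (rot5 v)) = v"
  unfolding carrier_C5_C5 rot5_def by (auto simp: mod_simps)

lemma rot5_hom: "rot5 \<in> hom C5_C5 C5_C5"
proof -
  have "(- ((b + d) mod 5)) mod 5 = ((- b) mod 5 + (- d) mod 5) mod 5"
    and "((a + c) mod 5 - (b + d) mod 5) mod 5 = ((a - b) mod 5 + (c - d) mod 5) mod 5"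
    for a b c d :: int
    by (simp_all only: mod_simps) (simp_all add: algebra_simps)
  then show ?thesis by (auto simp: hom_def rot5_def carrier_integer_mod_group)
qed

lemma rot5_pow_hom: "rot5 ^^ n \<in> hom C5_C5 C5_C5"
proof (induction n)
  case (Suc n)
  then show ?case using hom_compose[OF Suc rot5_hom] by (simp only: funpow.simps)
qed (simp add: hom_def)

lemma rot5_pow_cube: "v \<in> carrier C5_C5 \<Longrightarrow> (rot5 ^^ (n + 3)) v = (rot5 ^^ n) v"
  using rot5_cube[OF hom_in_carrier[OF rot5_pow_hom[of n]]]
  by (simp add: numeral_3_eq_3 del: carrier_DirProd)

lemma rot5_pow_mod: "v \<in> carrier C5_C5 \<Longrightarrow> (rot5 ^^ (n mod 3)) v = (rot5 ^^ n) v"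
proof (induction n rule: less_induct)
  case (less n)
  show ?case
  proof (cases "n < 3")
    case False
    then obtain m where "n = m + 3" by (metis add.commute le_Suc_ex not_less)
    with less show ?thesis by (simp add: rot5_pow_cube)
  qed simp
qed

lemma C3_action_auto: "C3_action k \<in> auto C5_C5"
proof -
  have hom: "C3_action k \<in> hom C5_C5 C5_C5"
    unfolding C3_action_def
    by (rule group.hom_restrict[OF group_C5_C5 rot5_pow_hom]) simp
  have "bij_betw (rot5 ^^ nat k) (carrier C5_C5) (carrier C5_C5)"
  proof -
    have cl: "rot5 v \<in> carrier C5_C5" if "v \<in> carrier C5_C5" for v
      using rot5_hom that by (rule hom_in_carrier)
    have "bij_betw rot5 (carrier C5_C5) (carrier C5_C5)"
      by (rule bij_betw_byWitness[where f' = "rot5 \<circ> rot5"])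
         (use rot5_cube cl in \<open>simp_all only: image_subset_iff comp_apply, blast+\<close>)
    then show ?thesis by (rule bij_betw_funpow)
  qed
  then show ?thesis
    using hom by (auto simp: auto_def Bij_def C3_action_def)
qed

lemma C3_action_hom: "C3_action \<in> hom (integer_mod_group 3) (AutoGroup C5_C5)"
proof (rule homI, goal_cases)
  case (1 k)
  then show ?case using C3_action_auto by (simp add: AutoGroup_def)
next
  case (2 j k)
  then have jk: "nat ((j + k) mod 3) = (nat j + nat k) mod 3"
    by (simp add: carrier_integer_mod_group nat_mod_distrib nat_add_distrib)
  have B: "C3_action i \<in> Bij (carrier C5_C5)" for i using C3_action_auto by (simp add: auto_def)
  have "C3_action ((j + k) mod 3) = compose (carrier C5_C5) (C3_action j) (C3_action k)"
    using hom_in_carrier[OF rot5_pow_hom]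
    by (auto simp: C3_action_def jk compose_def rot5_pow_mod funpow_add fun_eq_iff
             simp del: carrier_DirProd)
  with B show ?case by (simp add: AutoGroup_def BijGroup_def)
qed

lemma C3_action_nontrivial: "C3_action 1 (1, 0) \<noteq> (1, 0)"
  by (simp add: C3_action_def carrier_C5_C5 rot5_def)

lemma group_G75: "group G75"
  unfolding G75_def
  by (intro group_semidirect_product group_C5_C5 C3_action_hom) simp

lemma order_G75: "order G75 = 75"
  by (simp add: order_def G75_def semidirect_product_def carrier_C5_C5
      carrier_integer_mod_group card_cartesian_product)

end

theory Submission
  imports Defs "HOL-Algebra.Multiplicative_Group" "HOL-Algebra.Group_Action"
    "HOL-Computational_Algebra.Primes"
begin

text \<open>The proof only counts commuting pairs; neither characters nor the odd order theorem are
  needed. Write \<open>d\<close> for the commuting probability. It does not decrease under passing to normal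
  subgroups and quotients, and counting coset by coset shows that if every element outside a
  normal subgroup \<open>N\<close> of index \<open>a\<close> centralizes at most one \<open>r\<close>-th of \<open>N\<close>, then
  \<open>d(G) a\<^sup>2 \<le> d(N) + (d(G/N) a\<^sup>2 - 1) / r\<close>. In a group of odd order a subgroup of index 3 or 5 is
  normal, because a nontrivial double coset is disjoint from its inverse; so nonabelian simple
  groups of odd order have \<open>d \<le> 35/243\<close>, and minimal normal subgroups are abelian when \<open>d\<close> is
  larger.

  If \<open>G\<close> is not supersolvable, some chief factor is not cyclic. The counting bound for its
  centralizer \<open>C\<close> forces the factor to have order 25 and \<open>C\<close> to have index 3. Applied once more to
  \<open>C\<close> itself, it shows that \<open>C\<close> is abelian and that its subgroup of commutators with an element \<open>t\<close>
  outside \<open>C\<close> has order 25. This subgroup contains \<open>G'\<close>, meets the center trivially, and \<open>t\<close> acts on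
  it with \<open>1 + t + t\<^sup>2 = 0\<close>, as in the group of order 75.\<close>

section \<open>Double cosets in groups of odd order\<close>

text \<open>The constant is one value of a simple formula. If an abelian normal subgroup has index 3
  and every outside element centralizes exactly one \<open>n\<close>-th of it, then d = (1 + 8/n)/9.
  For n = 27 this is 35/243; for n = 25 it is 11/75, the value of the group of order 75. So the
  hypothesis on d says n < 27 there, and divisibility leaves 25. The other estimates meet the
  constant at their extreme values: order 27 with all nontrivial classes of size 9 for simple
  groups, and a nonabelian quotient of order 9 in the counting bound. Oddness enters through
  indices: a proper subgroup has index at least 3.

  The obstacle is that the noncyclic chief factor lives in a quotient of \<open>G\<close>, while
  isoclinism concerns \<open>G\<close> itself. What lifts is an inequality: an element outside
  \<open>C\<close> centralizes at most one 25th of \<open>C\<close>. It feeds a second count inside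
  \<open>G\<close>, where the index of the center in \<open>C\<close> takes over the role of the
  order of the chief factor. Isoclinism then comes from a homomorphism onto the group of order 75
  whose kernel avoids the derived subgroup.\<close>

lemma (in group) inv_mult_cancel:
  "\<lbrakk>x \<in> carrier G; y \<in> carrier G\<rbrakk> \<Longrightarrow> inv x \<otimes> (x \<otimes> y) = y"
  "\<lbrakk>x \<in> carrier G; y \<in> carrier G\<rbrakk> \<Longrightarrow> x \<otimes> (inv x \<otimes> y) = y"
  by (simp_all flip: m_assoc)

text \<open>A complete rewrite system for words in a group.\<close>

lemmas (in group) word_simps = m_assoc inv_mult_group inv_mult_cancel

lemma (in group) mult_eq_commute_iff:
  assumes "x \<in> carrier G" "y \<in> carrier G"
  shows "x \<otimes> y \<otimes> inv x \<otimes> inv y = \<one> \<longleftrightarrow> x \<otimes> y = y \<otimes> x"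
  using assms by (simp add: inv_solve_right')

text \<open>The blocks {\<open>x\<close>, \<open>f x\<close>} have two elements each and partition
  \<open>D\<close>.\<close>

lemma even_card_involution:
  assumes "finite D" and "\<And>x. x \<in> D \<Longrightarrow> f x \<in> D" and "\<And>x. x \<in> D \<Longrightarrow> f (f x) = x"
    and "\<And>x. x \<in> D \<Longrightarrow> f x \<noteq> x"
  shows "even (card D)"
proof -
  let ?C = "(\<lambda>x. {x, f x}) ` D"
  have "2 * card ?C = card (\<Union> ?C)"
  proof (rule card_partition)
    fix c assume "c \<in> ?C"
    then show "card c = 2" using assms(4) by force
  next
    fix c1 c2 assume c: "c1 \<in> ?C" "c2 \<in> ?C" "c1 \<noteq> c2"
    then obtain x y where xy: "x \<in> D" "y \<in> D" "c1 = {x, f x}" "c2 = {y, f y}" by auto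
    have "f x = y \<longleftrightarrow> x = f y" using xy(1,2) assms(3) by metis
    moreover have "f x = f y \<longleftrightarrow> x = y" using xy(1,2) assms(3) by metis
    ultimately show "c1 \<inter> c2 = {}" using c(3) xy by auto
  qed (use assms(1) in auto)
  also have "\<Union> ?C = D" using assms(2) by auto
  finally show ?thesis by (metis dvd_triv_left)
qed

section \<open>Finite groups: product sets and conjugate subgroups\<close>

locale finite_group = group +
  assumes fin: "finite (carrier G)"

context finite_group
begin

lemma finite_subgroup: "subgroup H G \<Longrightarrow> finite H"
  using fin finite_subset subgroup.subset by blast

lemma card_subgroup_pos: "subgroup H G \<Longrightarrow> 0 < card H"
  using fin subgroup.finite_imp_card_positive by blast

lemma card_subgroup_dvd:
  assumes "subgroup H G" "subgroup K G" "H \<subseteq> K"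
  shows "card H dvd card K"
proof -
  interpret K: group "G\<lparr>carrier := K\<rparr>" using assms(2) by (rule subgroup_imp_group)
  show ?thesis using K.lagrange[OF subgroup_incl[OF assms]] by (metis dvd_triv_right order_def partial_object.select_convs(1) partial_object.surjective partial_object.update_convs(1))
qed

text \<open>The fibre of multiplication over a b consists of the pairs (a i, i^-1 b) with i in
  \<open>A \<inter> B\<close>, so all fibres have the same size. The product set is in general not a
  subgroup.\<close>

lemma card_set_mult:
  assumes A: "subgroup A G" and B: "subgroup B G"
  shows "card (A <#> B) * card (A \<inter> B) = card A * card B"
proof -
  note [simp] = subgroup.mem_carrier[OF A] subgroup.mem_carrier[OF B]
    subgroup.m_closed[OF A] subgroup.m_closed[OF B]
    subgroup.m_inv_closed[OF A] subgroup.m_inv_closed[OF B]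
  have f: "finite A" "finite B" using A B by (auto intro: finite_subgroup)
  have *: "card {p \<in> A \<times> B. fst p \<otimes> snd p = q} = card (A \<inter> B)" if "q \<in> A <#> B" for q
  proof -
    obtain a b where ab: "a \<in> A" "b \<in> B" "q = a \<otimes> b" using \<open>q \<in> A <#> B\<close> by (auto simp: set_mult_def)
    have "bij_betw (\<lambda>i. (a \<otimes> i, inv i \<otimes> b)) (A \<inter> B) {p \<in> A \<times> B. fst p \<otimes> snd p = q}"
    proof (rule bij_betw_byWitness[where f' = "\<lambda>p. inv a \<otimes> fst p"])
      have *: "inv a \<otimes> x \<in> A \<inter> B \<and> inv (inv a \<otimes> x) \<otimes> b = y"
        if xy: "x \<in> A" "y \<in> B" "x \<otimes> y = q" for x y
      proof
        have "x = a \<otimes> b \<otimes> inv y" using xy ab by (simp add: inv_solve_right)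
        then have "inv a \<otimes> x = b \<otimes> inv y" using ab xy by (simp add: word_simps)
        then show "inv a \<otimes> x \<in> A \<inter> B"
          using ab xy by (metis A B IntI subgroup.m_closed subgroup.m_inv_closed)
        have "inv x \<otimes> (a \<otimes> b) = y" using xy ab by (simp add: inv_solve_left')
        then show "inv (inv a \<otimes> x) \<otimes> b = y" using ab xy by (simp add: word_simps)
      qed
      show "(\<lambda>p. inv a \<otimes> fst p) ` {p \<in> A \<times> B. fst p \<otimes> snd p = q} \<subseteq> A \<inter> B"
        using * by auto
      show "\<forall>p \<in> {p \<in> A \<times> B. fst p \<otimes> snd p = q}. (a \<otimes> (inv a \<otimes> fst p), inv (inv a \<otimes> fst p) \<otimes> b) = p"
        using * ab by (auto simp: word_simps)
    qed (use ab in \<open>auto simp: word_simps\<close>)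
    then show ?thesis by (simp add: bij_betw_same_card)
  qed
  have "card A * card B = card (A \<times> B)" by (simp add: card_cartesian_product)
  also have "\<dots> = (\<Sum>q \<in> A <#> B. card {p \<in> A \<times> B. fst p \<otimes> snd p = q})"
  proof -
    have "A <#> B = (\<lambda>p. fst p \<otimes> snd p) ` (A \<times> B)" by (force simp: set_mult_def)
    then show ?thesis
      using sum.image_gen[of "A \<times> B" "\<lambda>_. 1::nat" "\<lambda>p. fst p \<otimes> snd p"] f by simp
  qed
  finally show ?thesis using * by simp
qed

definition conj_set :: "'a \<Rightarrow> 'a set \<Rightarrow> 'a set" where
  "conj_set g H = (\<lambda>h. g \<otimes> h \<otimes> inv g) ` H"

lemma conj_inj: "g \<in> carrier G \<Longrightarrow> H \<subseteq> carrier G \<Longrightarrow> inj_on (\<lambda>h. g \<otimes> h \<otimes> inv g) H"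
  by (rule inj_onI) (simp add: subset_iff)

lemma card_conj: "g \<in> carrier G \<Longrightarrow> H \<subseteq> carrier G \<Longrightarrow> card (conj_set g H) = card H"
  unfolding conj_set_def by (intro card_image conj_inj)

lemma subgroup_conj:
  assumes "g \<in> carrier G" "subgroup H G"
  shows "subgroup (conj_set g H) G"
proof -
  have "group_hom G G (\<lambda>h. g \<otimes> h \<otimes> inv g)"
    by unfold_locales (use assms(1) in \<open>auto simp: hom_def word_simps\<close>)
  then show ?thesis unfolding conj_set_def using assms(2) by (rule group_hom.subgroup_img_is_subgroup)
qed

lemma conj_subset: "subgroup H G \<Longrightarrow> g \<in> H \<Longrightarrow> I \<subseteq> H \<Longrightarrow> conj_set g I \<subseteq> H"
  by (auto simp: conj_set_def subgroup.m_closed subgroup.m_inv_closed subset_iff)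

end

section \<open>Subgroup indices in groups of odd order\<close>

locale odd_group = finite_group +
  assumes odd: "odd (order G)"

context odd_group
begin

lemma odd_card_subgroup: "subgroup H G \<Longrightarrow> odd (card H)"
  using odd lagrange by (metis even_mult_iff)

text \<open>The index is an odd number other than 1.\<close>

lemma card_proper_subgroup:
  assumes "subgroup H G" "subgroup K G" "H \<subset> K"
  shows "3 * card H \<le> card K"
proof -
  obtain m where m: "card K = card H * m"
    using card_subgroup_dvd[OF assms(1,2)] assms(3) by (auto elim: dvdE)
  have "odd m" using m odd_card_subgroup[OF assms(2)] by simp
  moreover have "card H < card K" using assms finite_subgroup psubset_card_mono by blast
  then have "m \<noteq> 1" using m by auto
  ultimately have "3 \<le> m" by presburger
  then show ?thesis unfolding m by simp
qed

lemma subgroup_eq_carrier: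
  assumes "subgroup H G" "order G < 3 * card H"
  shows "H = carrier G"
  using card_proper_subgroup[OF assms(1) subgroup_self] assms subgroup.subset[OF assms(1)]
  by (auto simp: order_def)

lemma involution_trivial:
  assumes "x \<in> carrier G" "inv x = x"
  shows "x = \<one>"
proof -
  have "x [^] (2::nat) = \<one>" using assms by (metis numeral_2_eq_2 nat_pow_Suc nat_pow_0 l_one r_inv)
  then have "ord x dvd 2" using assms pow_eq_id by blast
  moreover have "odd (ord x)" using odd ord_dvd_group_order[OF assms(1)] dvd_trans by blast
  ultimately have "ord x = 1" using two_is_prime_nat by (metis dvd_refl prime_nat_iff)
  then show ?thesis using ord_eq_1 assms by blast
qed

text \<open>A double coset of \<open>I\<close> other than \<open>I\<close> has odd size, so it is not closed under inversion;
  hence it is disjoint from its inverse.\<close>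

lemma card_double_coset:
  assumes I: "subgroup I G" and H: "subgroup H G" and IH: "I \<subseteq> H" and h: "h \<in> H" "h \<notin> I"
  shows "2 * card (I <#> conj_set h I) + card I \<le> card H"
proof -
  have hc: "h \<in> carrier G" using h H by (blast dest: subgroup.mem_carrier)
  note [simp] = subgroup.mem_carrier[OF I] subgroup.m_closed[OF I] subgroup.m_inv_closed[OF I]
  define D where "D = {a \<otimes> h \<otimes> b | a b. a \<in> I \<and> b \<in> I}"
  have DH: "D \<subseteq> H" unfolding D_def using IH h by (auto intro!: subgroup.m_closed[OF H])
  have fD: "finite D" using DH finite_subgroup[OF H] finite_subset by blast
  have Dc: "D \<subseteq> carrier G" using DH subgroup.subset[OF H] by blast
  \<comment> \<open>The double coset is a right translate of a product set, so the product formula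
    gives its size, a divisor of the odd number \<open>card I * card I\<close>.\<close>
  have "D = (\<lambda>x. x \<otimes> h) ` (I <#> conj_set h I)"
    unfolding D_def set_mult_def conj_set_def using hc by (force simp: word_simps)
  moreover have "I <#> conj_set h I \<subseteq> carrier G"
    by (intro setmult_subset_G) (use I hc subgroup_conj subgroup.subset in blast)+
  ultimately have cD: "card D = card (I <#> conj_set h I)"
    using inj_on_multc[OF hc] by (metis card_image inj_on_subset)
  have "card D * card (I \<inter> conj_set h I) = card I * card I"
    using cD card_set_mult[OF I subgroup_conj[OF hc I]] card_conj[OF hc subgroup.subset[OF I]]
    by simp
  then have oddD: "odd (card D)" using odd_card_subgroup[OF I] by (metis even_mult_iff)
  have disj: "D \<inter> I = {}"
  proof (rule ccontr)
    assume "D \<inter> I \<noteq> {}"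
    then obtain a b where ab: "a \<in> I" "b \<in> I" "a \<otimes> h \<otimes> b \<in> I" by (auto simp: D_def)
    then have "inv a \<otimes> (a \<otimes> h \<otimes> b) \<otimes> inv b \<in> I"
      using subgroup.m_closed[OF I] subgroup.m_inv_closed[OF I] by metis
    then show False using ab hc h by (simp add: word_simps)
  qed
  let ?D' = "m_inv G ` D"
  have disj': "D \<inter> ?D' = {}"
  proof (rule ccontr)
    assume "D \<inter> ?D' \<noteq> {}"
    then obtain a b c d where ab: "a \<in> I" "b \<in> I" "c \<in> I" "d \<in> I"
      and eq: "a \<otimes> h \<otimes> b = inv (c \<otimes> h \<otimes> d)" unfolding D_def by force
    \<comment> \<open>A common element of \<open>D\<close> and \<open>?D'\<close> puts
      \<open>inv h\<close> into \<open>D\<close>. Then all of \<open>D\<close> is closed under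
      inversion, which has no fixed point there since \<open>\<one>\<close> is not in
      \<open>D\<close>.\<close>
    have "inv h = d \<otimes> inv (c \<otimes> h \<otimes> d) \<otimes> c" using ab hc by (simp add: word_simps)
    also have "\<dots> = (d \<otimes> a) \<otimes> h \<otimes> (b \<otimes> c)" unfolding eq[symmetric] using ab hc by (simp add: word_simps)
    finally have ih: "inv h = (d \<otimes> a) \<otimes> h \<otimes> (b \<otimes> c)" .
    have "even (card D)"
    proof (rule even_card_involution[where f = "m_inv G"])
      fix x assume x: "x \<in> D"
      then obtain u v where uv: "u \<in> I" "v \<in> I" "x = u \<otimes> h \<otimes> v" by (auto simp: D_def)
      have "inv x = inv v \<otimes> inv h \<otimes> inv u" using uv hc by (simp add: word_simps)
      also have "\<dots> = (inv v \<otimes> (d \<otimes> a)) \<otimes> h \<otimes> (b \<otimes> c \<otimes> inv u)"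
        unfolding ih using ab uv hc by (simp add: word_simps)
      finally show "inv x \<in> D" using ab uv by (force simp: D_def)
      show "inv (inv x) = x" using x Dc by auto
      show "inv x \<noteq> x" using involution_trivial x Dc disj subgroup.one_closed[OF I] by blast
    qed (rule fD)
    with oddD show False ..
  qed
  have "inj_on (m_inv G) D" using inv_inj inj_on_subset Dc by blast
  then have cD': "card ?D' = card D" by (rule card_image)
  have "inv x \<in> I \<Longrightarrow> x \<in> I" if "x \<in> D" for x
    using that Dc by (metis inv_inv subgroup.m_inv_closed[OF I] subsetD)
  then have disj'': "?D' \<inter> I = {}" using disj by auto
  have "card (D \<union> ?D' \<union> I) = card D + card ?D' + card I"
    using fD finite_subgroup[OF I] disj disj' disj'' by (subst card_Un_disjoint; auto simp: card_Un_disjoint)+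
  moreover have "D \<union> ?D' \<union> I \<subseteq> H" using DH IH subgroup.m_inv_closed[OF H] by auto
  then have "card (D \<union> ?D' \<union> I) \<le> card H" by (intro card_mono finite_subgroup[OF H])
  ultimately show ?thesis using cD cD' by simp
qed

text \<open>Here \<open>k\<close> is the index of the intersection in \<open>I\<close>. The product
  of \<open>I\<close> with its conjugate has \<open>k * card I\<close> elements, so
  \<open>card_double_coset\<close> reads \<open>2 * k + 1 \<le> m\<close> after cancelling
  \<open>card I\<close>; and \<open>k = 1\<close> would identify \<open>I\<close> with its
  conjugate.\<close>

lemma conj_index:
  assumes I: "subgroup I G" and H: "subgroup H G" and IH: "I \<subseteq> H" and h: "h \<in> H"
    and m: "card H = m * card I" and ne: "conj_set h I \<noteq> I"
  obtains k where "odd k" "3 \<le> k" "2 * k + 1 \<le> m" "card I = k * card (I \<inter> conj_set h I)"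
proof -
  have hc: "h \<in> carrier G" using h H by (blast dest: subgroup.mem_carrier)
  have hI: "h \<notin> I"
  proof
    assume "h \<in> I"
    then have "conj_set h I \<subseteq> I" using conj_subset[OF I] by simp
    with ne show False
      using card_conj[OF hc subgroup.subset[OF I]] card_subset_eq finite_subgroup[OF I] by blast
  qed
  let ?J = "I \<inter> conj_set h I"
  have J: "subgroup ?J G" using I subgroup_conj[OF hc I] by (rule subgroups_Inter_pair)
  then obtain k where k: "card I = card ?J * k"
    using card_subgroup_dvd[OF J I] by (auto elim: dvdE)
  have pos: "0 < card ?J" "0 < card I" using J I card_subgroup_pos by auto
  have "card (I <#> conj_set h I) * card ?J = card I * card I"
    using card_set_mult[OF I subgroup_conj[OF hc I]] card_conj[OF hc subgroup.subset[OF I]] by simp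
  then have "card (I <#> conj_set h I) * card ?J = k * card I * card ?J" using k by (simp add: algebra_simps)
  then have "card (I <#> conj_set h I) = k * card I" using pos by simp
  with card_double_coset[OF I H IH h hI] m have "(2 * k + 1) * card I \<le> m * card I"
    by (simp add: algebra_simps)
  then have "2 * k + 1 \<le> m" using pos mult_right_le_imp_le by blast
  moreover have "odd k" using k odd_card_subgroup[OF I] by simp
  moreover have "k \<noteq> 1"
  proof
    assume "k = 1"
    then have "?J = I" using k card_subset_eq[of I ?J] finite_subgroup[OF I] by simp
    then have "I \<subseteq> conj_set h I" by blast
    then have "I = conj_set h I" using card_conj[OF hc subgroup.subset[OF I]]
      finite_subgroup[OF subgroup_conj[OF hc I]] by (intro card_subset_eq) auto
    with ne show False by simp
  qed
  then have "3 \<le> k" using \<open>odd k\<close> by presburger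
  ultimately show thesis using that k by (simp add: mult.commute)
qed

text \<open>Two different conjugates would have \<open>k \<ge> 3\<close> in
  \<open>conj_index\<close>, forcing \<open>m \<ge> 7\<close>.\<close>

lemma small_index_conj:
  assumes "subgroup I G" "subgroup H G" "I \<subseteq> H" "h \<in> H" "card H = m * card I" "m < 7"
  shows "conj_set h I = I"
proof (rule ccontr)
  assume "conj_set h I \<noteq> I"
  then obtain k where "3 \<le> k" "2 * k + 1 \<le> m" using conj_index[OF assms(1-5)] by metis
  with assms(6) show False by simp
qed

end

section \<open>Commuting pairs and quotients\<close>

text \<open>\<open>B\<close> is an arbitrary set because the counting also takes cosets for it, and
  \<open>x\<close> may lie outside \<open>B\<close>.\<close>

definition centralizer_in :: "('a, 'b) monoid_scheme \<Rightarrow> 'a set \<Rightarrow> 'a \<Rightarrow> 'a set" where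
  "centralizer_in G B x = {y \<in> B. x \<otimes>\<^bsub>G\<^esub> y = y \<otimes>\<^bsub>G\<^esub> x}"

definition commuting_pairs :: "('a, 'b) monoid_scheme \<Rightarrow> 'a set \<Rightarrow> 'a set \<Rightarrow> ('a \<times> 'a) set" where
  "commuting_pairs G A B = {(x, y). x \<in> A \<and> y \<in> B \<and> x \<otimes>\<^bsub>G\<^esub> y = y \<otimes>\<^bsub>G\<^esub> x}"

lemma commuting_probability_eq:
  "commuting_probability G = card (commuting_pairs G (carrier G) (carrier G)) / (card (carrier G))\<^sup>2"
  by (simp add: commuting_probability_def commuting_pairs_def order_def)

lemma commuting_probability_subgroup:
  "commuting_probability (G\<lparr>carrier := H\<rparr>) = card (commuting_pairs G H H) / (card H)\<^sup>2"
  by (simp add: commuting_probability_def commuting_pairs_def order_def)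

lemma commuting_pairs_Sigma: "commuting_pairs G A B = Sigma A (centralizer_in G B)"
  by (auto simp: commuting_pairs_def centralizer_in_def)

lemma finite_commuting_pairs: "finite A \<Longrightarrow> finite B \<Longrightarrow> finite (commuting_pairs G A B)"
  by (rule finite_subset[of _ "A \<times> B"]) (auto simp: commuting_pairs_def)

lemma finite_centralizer_in: "finite B \<Longrightarrow> finite (centralizer_in G B x)"
  by (simp add: centralizer_in_def)

lemma card_commuting_pairs:
  "finite A \<Longrightarrow> finite B \<Longrightarrow> card (commuting_pairs G A B) = (\<Sum>x\<in>A. card (centralizer_in G B x))"
  unfolding commuting_pairs_Sigma by (intro card_SigmaI) (auto intro: finite_centralizer_in)

lemma card_commuting_pairs_sym: "card (commuting_pairs G A B) = card (commuting_pairs G B A)"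
proof -
  have "commuting_pairs G B A = prod.swap ` commuting_pairs G A B"
    by (force simp: commuting_pairs_def)
  then show ?thesis by (simp add: card_image)
qed

context group
begin

lemma subgroup_centralizer_in:
  assumes "subgroup H G" "x \<in> carrier G"
  shows "subgroup (centralizer_in G H x) G"
proof (rule subgroupI)
  fix y assume y: "y \<in> centralizer_in G H x"
  then have "y \<in> carrier G" using subgroup.mem_carrier[OF assms(1)] by (simp add: centralizer_in_def)
  then have "x \<otimes> inv y = inv y \<otimes> (y \<otimes> x) \<otimes> inv y" using assms(2) by (simp add: word_simps)
  also have "y \<otimes> x = x \<otimes> y" using y by (simp add: centralizer_in_def)
  also have "inv y \<otimes> (x \<otimes> y) \<otimes> inv y = inv y \<otimes> x"
    using \<open>y \<in> carrier G\<close> assms(2) by (simp add: word_simps)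
  finally have "x \<otimes> inv y = inv y \<otimes> x" .
  then show "inv y \<in> centralizer_in G H x"
    using y subgroup.m_inv_closed[OF assms(1)] by (simp add: centralizer_in_def)
next
  fix y z assume y: "y \<in> centralizer_in G H x" "z \<in> centralizer_in G H x"
  then have "y \<in> carrier G" "z \<in> carrier G"
    using subgroup.mem_carrier[OF assms(1)] by (auto simp: centralizer_in_def)
  then have "x \<otimes> (y \<otimes> z) = y \<otimes> x \<otimes> z" using y assms(2)
    by (simp add: centralizer_in_def flip: m_assoc)
  also have "\<dots> = y \<otimes> z \<otimes> x"
    using y assms(2) \<open>y \<in> carrier G\<close> \<open>z \<in> carrier G\<close> by (simp add: centralizer_in_def m_assoc)
  finally have "x \<otimes> (y \<otimes> z) = y \<otimes> z \<otimes> x" .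
  then show "y \<otimes> z \<in> centralizer_in G H x"
    using y subgroup.m_closed[OF assms(1)] by (simp add: centralizer_in_def)
qed (use assms subgroup.one_closed[OF assms(1)] subgroup.subset[OF assms(1)] in
      \<open>auto simp: centralizer_in_def subset_iff\<close>)

lemma comm_group_iff: "comm_group G \<longleftrightarrow> (\<forall>x\<in>carrier G. centralizer_in G (carrier G) x = carrier G)"
proof
  assume "comm_group G"
  then interpret comm_group G .
  show "\<forall>x\<in>carrier G. centralizer_in G (carrier G) x = carrier G"
    by (auto simp: centralizer_in_def m_comm)
next
  assume "\<forall>x\<in>carrier G. centralizer_in G (carrier G) x = carrier G"
  then show "comm_group G" by (intro group_comm_groupI) (auto simp: centralizer_in_def)
qed

end

section \<open>Counting commuting pairs coset by coset\<close>

context finite_group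
begin

lemma commuting_probability_bounds: "0 < commuting_probability G" "commuting_probability G \<le> 1"
proof -
  have "commuting_pairs G (carrier G) (carrier G) \<subseteq> carrier G \<times> carrier G"
    by (auto simp: commuting_pairs_def)
  then have "card (commuting_pairs G (carrier G) (carrier G)) \<le> (card (carrier G))\<^sup>2"
    using card_mono[of "carrier G \<times> carrier G"] fin
    by (metis card_cartesian_product finite_cartesian_product power2_eq_square)
  then have "real (card (commuting_pairs G (carrier G) (carrier G))) \<le> (real (card (carrier G)))\<^sup>2"
    by (metis of_nat_le_iff of_nat_power)
  then show "commuting_probability G \<le> 1"
    unfolding commuting_probability_eq by (simp add: divide_le_eq)
  have "(\<one>, \<one>) \<in> commuting_pairs G (carrier G) (carrier G)" by (simp add: commuting_pairs_def)
  then have "0 < card (commuting_pairs G (carrier G) (carrier G))"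
    using finite_commuting_pairs[OF fin fin] card_gt_0_iff by blast
  moreover have "0 < card (carrier G)" using fin one_closed card_gt_0_iff by blast
  ultimately show "0 < commuting_probability G"
    unfolding commuting_probability_eq by simp
qed

text \<open>If some \<open>y\<close> in the coset commutes with \<open>x\<close>, then
  \<open>n \<otimes> y\<close> commutes with \<open>x\<close> only if \<open>n\<close> does. So the
  left-hand set is empty or contained in a translate of the right-hand one.\<close>

lemma card_centralizer_in_coset:
  assumes N: "subgroup N G" and b: "\<beta> \<in> rcosets N" and x: "x \<in> carrier G"
  shows "card (centralizer_in G \<beta> x) \<le> card (centralizer_in G N x)"
proof (cases "centralizer_in G \<beta> x = {}")
  case False
  then obtain y where y: "y \<in> \<beta>" "x \<otimes> y = y \<otimes> x" by (auto simp: centralizer_in_def)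
  obtain b where b: "b \<in> carrier G" "\<beta> = N #> b" using b by (auto simp: RCOSETS_def)
  have yc: "y \<in> carrier G" using y b N r_coset_subset_G subgroup.subset by blast
  have bc: "\<beta> = N #> y" using y b N repr_independence by blast
  note [simp] = subgroup.mem_carrier[OF N] yc x
  have "centralizer_in G \<beta> x \<subseteq> (\<lambda>n. n \<otimes> y) ` centralizer_in G N x"
  proof
    fix z assume "z \<in> centralizer_in G \<beta> x"
    then obtain n where n: "n \<in> N" "z = n \<otimes> y" "x \<otimes> (n \<otimes> y) = n \<otimes> y \<otimes> x"
      by (auto simp: centralizer_in_def bc r_coset_def)
    then have "x \<otimes> n \<otimes> y = n \<otimes> x \<otimes> y" using y by (simp add: m_assoc)
    then have "x \<otimes> n = n \<otimes> x" using n by simp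
    then show "z \<in> (\<lambda>n. n \<otimes> y) ` centralizer_in G N x" using n by (auto simp: centralizer_in_def)
  qed
  then show ?thesis
    using surj_card_le[OF finite_centralizer_in[OF finite_subgroup[OF N]]] by simp
qed simp

lemma card_commuting_pairs_coset:
  assumes "subgroup N G" "\<beta> \<in> rcosets N" "A \<subseteq> carrier G"
  shows "card (commuting_pairs G A \<beta>) \<le> card (commuting_pairs G A N)"
proof -
  have f: "finite A" "finite N" using assms fin finite_subgroup finite_subset by auto
  have "finite \<beta>" using cosets_finite[OF assms(2) subgroup.subset[OF assms(1)] fin] .
  note f = f(1) this f(2)
  show ?thesis unfolding card_commuting_pairs[OF f(1,2)] card_commuting_pairs[OF f(1,3)]
    using card_centralizer_in_coset[OF assms(1,2)] assms(3) by (intro sum_mono) blast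
qed

lemma card_commuting_pairs_cosets:
  assumes "subgroup N G" "\<alpha> \<in> rcosets N" "\<beta> \<in> rcosets N"
  shows "card (commuting_pairs G \<alpha> \<beta>) \<le> card (commuting_pairs G N N)"
proof -
  have "\<alpha> \<subseteq> carrier G" using assms subgroup.rcosets_carrier group_axioms by blast
  then have "card (commuting_pairs G \<alpha> \<beta>) \<le> card (commuting_pairs G \<alpha> N)"
    using assms by (intro card_commuting_pairs_coset)
  also have "\<dots> = card (commuting_pairs G N \<alpha>)" by (rule card_commuting_pairs_sym)
  also have "\<dots> \<le> card (commuting_pairs G N N)"
    using assms by (intro card_commuting_pairs_coset subgroup.subset)
  finally show ?thesis .
qed

text \<open>All \<open>card N\<close> elements of \<open>\<alpha>\<close> lie outside
  \<open>N\<close>, and each has at most \<open>card N / r\<close> partners in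
  \<open>\<beta>\<close>, no more than in \<open>N\<close> itself.\<close>

lemma card_commuting_pairs_outside:
  assumes N: "subgroup N G" and a: "\<alpha> \<in> rcosets N" and b: "\<beta> \<in> rcosets N" and ne: "\<alpha> \<noteq> N"
    and r: "\<And>x. x \<in> carrier G - N \<Longrightarrow> r * card (centralizer_in G N x) \<le> card N"
  shows "r * card (commuting_pairs G \<alpha> \<beta>) \<le> (card N)\<^sup>2"
proof -
  have ac: "\<alpha> \<subseteq> carrier G" using a N subgroup.rcosets_carrier group_axioms by blast
  have aN: "\<alpha> \<inter> N = {}"
    using rcos_disjoint[OF N] a ne subgroup.subgroup_in_rcosets[OF N group_axioms]
    by (auto simp: pairwise_def disjnt_def)
  have f: "finite \<alpha>" "finite N" using ac fin finite_subset N finite_subgroup by auto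
  have "r * card (commuting_pairs G \<alpha> \<beta>) \<le> r * card (commuting_pairs G \<alpha> N)"
    using card_commuting_pairs_coset[OF N b ac] by simp
  also have "\<dots> = (\<Sum>x\<in>\<alpha>. r * card (centralizer_in G N x))"
    by (simp add: card_commuting_pairs[OF f] sum_distrib_left)
  also have "\<dots> \<le> (\<Sum>x\<in>\<alpha>. card N)" using r aN ac by (intro sum_mono) blast
  also have "\<dots> = (card N)\<^sup>2"
    using card_rcosets_equal[OF a] subgroup.subset[OF N] by (simp add: power2_eq_square)
  finally show ?thesis .
qed

text \<open>Commuting representatives make their cosets commute. Contraposed, this removes from the
  double sum all pairs of cosets that do not commute in the quotient.\<close>

lemma commuting_pairs_cosets_empty:
  assumes N: "N \<lhd> G" and "\<alpha> \<in> rcosets N" "\<beta> \<in> rcosets N" and "commuting_pairs G \<alpha> \<beta> \<noteq> {}"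
  shows "\<alpha> <#> \<beta> = \<beta> <#> \<alpha>"
proof -
  interpret normal N G by fact
  obtain x y where xy: "x \<in> \<alpha>" "y \<in> \<beta>" "x \<otimes> y = y \<otimes> x"
    using assms(4) by (auto simp: commuting_pairs_def)
  obtain a b where "a \<in> carrier G" "\<alpha> = N #> a" "b \<in> carrier G" "\<beta> = N #> b"
    using assms(2,3) by (auto simp: RCOSETS_def)
  then have "\<alpha> = N #> x" "\<beta> = N #> y" "x \<in> carrier G" "y \<in> carrier G"
    using xy repr_independence is_subgroup r_coset_subset_G subset by blast+
  then show ?thesis using xy by (simp add: rcos_sum)
qed

lemma finite_rcosets: "subgroup N G \<Longrightarrow> finite (rcosets N)"
  using fin rcosets_part_G by (metis finite_UnionD)

text \<open>The blocks \<open>\<alpha> \<times> \<beta>\<close> partition the pairs of elements, and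
  blocks of noncommuting cosets contribute nothing.\<close>

lemma card_commuting_pairs_quotient:
  assumes N: "N \<lhd> G"
  shows "card (commuting_pairs G (carrier G) (carrier G)) =
    (\<Sum>(\<alpha>, \<beta>) \<in> commuting_pairs (G Mod N) (carrier (G Mod N)) (carrier (G Mod N)).
       card (commuting_pairs G \<alpha> \<beta>))"
proof -
  have S: "subgroup N G" using N by (rule normal_imp_subgroup)
  have R: "carrier (G Mod N) = rcosets N" by (simp add: FactGroup_def)
  have fR: "finite (rcosets N)" using S by (rule finite_rcosets)
  have fc: "finite \<alpha>" if "\<alpha> \<in> rcosets N" for \<alpha>
    using that S cosets_finite fin subgroup.subset by blast
  have U: "\<Union> (rcosets N) = carrier G" using S rcosets_part_G by blast
  have disj: "\<alpha> \<inter> \<beta> = {}" if "\<alpha> \<in> rcosets N" "\<beta> \<in> rcosets N" "\<alpha> \<noteq> \<beta>" for \<alpha> \<beta>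
    using rcos_disjoint[OF S] that by (auto simp: pairwise_def disjnt_def)
  let ?I = "(rcosets N) \<times> (rcosets N)"
  have "commuting_pairs G (carrier G) (carrier G) = (\<Union>(\<alpha>, \<beta>)\<in>?I. commuting_pairs G \<alpha> \<beta>)"
    unfolding commuting_pairs_def U[symmetric] by auto
  then have "card (commuting_pairs G (carrier G) (carrier G)) = card (\<Union>(\<alpha>, \<beta>)\<in>?I. commuting_pairs G \<alpha> \<beta>)"
    by simp
  also have "\<dots> = (\<Sum>p\<in>?I. card (case p of (\<alpha>, \<beta>) \<Rightarrow> commuting_pairs G \<alpha> \<beta>))"
  proof (rule card_UN_disjoint)
    show "\<forall>i\<in>?I. \<forall>j\<in>?I. i \<noteq> j \<longrightarrow> (case i of (\<alpha>, \<beta>) \<Rightarrow> commuting_pairs G \<alpha> \<beta>) \<inter> (case j of (\<alpha>, \<beta>) \<Rightarrow> commuting_pairs G \<alpha> \<beta>) = {}"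
      using disj unfolding commuting_pairs_def by fastforce
  qed (use fR in \<open>auto intro!: finite_commuting_pairs fc\<close>)
  also have "\<dots> = (\<Sum>p\<in>commuting_pairs (G Mod N) (rcosets N) (rcosets N). card (case p of (\<alpha>, \<beta>) \<Rightarrow> commuting_pairs G \<alpha> \<beta>))"
  proof (rule sum.mono_neutral_right)
    show "\<forall>p \<in> ?I - commuting_pairs (G Mod N) (rcosets N) (rcosets N). card (case p of (\<alpha>, \<beta>) \<Rightarrow> commuting_pairs G \<alpha> \<beta>) = 0"
      using commuting_pairs_cosets_empty[OF N] unfolding commuting_pairs_def[of "G Mod N"]
      by (clarsimp split: prod.splits) (metis card.empty less_irrefl)
  qed (use fR in \<open>auto simp: commuting_pairs_def[of "G Mod N"]\<close>)
  finally show ?thesis unfolding R by (simp add: case_prod_unfold)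
qed

lemma finite_group_quotient:
  assumes "N \<lhd> G"
  shows "finite_group (G Mod N)"
proof -
  interpret Q: group "G Mod N" using assms by (rule normal.factorgroup_is_group)
  show ?thesis by unfold_locales (simp add: FactGroup_def finite_rcosets normal_imp_subgroup assms)
qed

text \<open>A commuting pair of cosets other than \<open>(N, N)\<close> contains at most \<open>(card N)\<^sup>2 / r\<close> commuting pairs of
  elements.\<close>

theorem commuting_probability_quotient_bound:
  assumes N: "N \<lhd> G" and "0 < r"
    and r: "\<And>x. x \<in> carrier G - N \<Longrightarrow> r * card (centralizer_in G N x) \<le> card N"
  defines "a \<equiv> real (card (rcosets N))"
  shows "commuting_probability G * a\<^sup>2 \<le> commuting_probability (G\<lparr>carrier := N\<rparr>)
          + (commuting_probability (G Mod N) * a\<^sup>2 - 1) / r"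
proof -
  have S: "subgroup N G" using N by (rule normal_imp_subgroup)
  let ?R = "rcosets N" and ?n = "real (card N)"
  let ?P = "commuting_pairs (G Mod N) ?R ?R"
  let ?f = "\<lambda>(\<alpha>, \<beta>). card (commuting_pairs G \<alpha> \<beta>)"
  have R: "carrier (G Mod N) = ?R" by (simp add: FactGroup_def)
  have NR: "N \<in> ?R" using S subgroup.subgroup_in_rcosets group_axioms by blast
  have fP: "finite ?P" by (intro finite_commuting_pairs finite_rcosets S)
  have mem: "(N, N) \<in> ?P" using NR by (simp add: commuting_pairs_def)
  have n0: "0 < ?n" using card_subgroup_pos[OF S] by simp
  have a0: "0 < a" unfolding a_def using NR finite_rcosets[OF S] card_gt_0_iff by fastforce
  have og: "real (card (carrier G)) = a * ?n"
    unfolding a_def using lagrange[OF S] by (metis of_nat_mult order_def)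
  have le: "real (?f p) \<le> ?n\<^sup>2 / r" if p: "p \<in> ?P - {(N, N)}" for p
  proof -
    obtain \<alpha> \<beta> where p: "p = (\<alpha>, \<beta>)" "\<alpha> \<in> ?R" "\<beta> \<in> ?R" "\<alpha> \<noteq> N \<or> \<beta> \<noteq> N"
      using p by (cases p) (auto simp: commuting_pairs_def)
    have "r * card (commuting_pairs G \<alpha> \<beta>) \<le> (card N)\<^sup>2"
    proof (cases "\<alpha> = N")
      case True
      then have "r * card (commuting_pairs G \<beta> \<alpha>) \<le> (card N)\<^sup>2"
        using p r by (intro card_commuting_pairs_outside[OF S]) auto
      then show ?thesis by (simp add: card_commuting_pairs_sym)
    next
      case False
      then show ?thesis using p r by (intro card_commuting_pairs_outside[OF S]) auto
    qed
    then have "real (r * card (commuting_pairs G \<alpha> \<beta>)) \<le> ?n\<^sup>2" by (metis of_nat_le_iff of_nat_power)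
    then show ?thesis using p \<open>0 < r\<close> by (simp add: field_simps)
  qed
  have "real (card (commuting_pairs G (carrier G) (carrier G))) = (\<Sum>p\<in>?P. real (?f p))"
    unfolding card_commuting_pairs_quotient[OF N] R by simp
  also have "\<dots> = real (?f (N, N)) + (\<Sum>p\<in>?P - {(N, N)}. real (?f p))"
    using fP mem by (rule sum.remove)
  also have "(\<Sum>p\<in>?P - {(N, N)}. real (?f p)) \<le> (\<Sum>p\<in>?P - {(N, N)}. ?n\<^sup>2 / r)"
    by (intro sum_mono le)
  also have "\<dots> = (card ?P - 1) * (?n\<^sup>2 / r)"
    using mem fP by (simp add: card_Diff_singleton)
  \<comment> \<open>The natural subtraction does not truncate, because \<open>(N, N)\<close> lies in
    \<open>?P\<close>.\<close>
  also have "real (card ?P - 1) = real (card ?P) - 1"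
    using mem fP by (metis One_nat_def Suc_leI card_gt_0_iff empty_iff of_nat_1 of_nat_diff)
  finally have *: "real (card (commuting_pairs G (carrier G) (carrier G)))
     \<le> card (commuting_pairs G N N) + (real (card ?P) - 1) * (?n\<^sup>2 / r)" by simp
  have "commuting_probability G * a\<^sup>2 = real (card (commuting_pairs G (carrier G) (carrier G))) / ?n\<^sup>2"
    unfolding commuting_probability_eq using og a0 by (simp add: power_mult_distrib)
  also have "\<dots> \<le> (card (commuting_pairs G N N) + (real (card ?P) - 1) * (?n\<^sup>2 / r)) / ?n\<^sup>2"
    using * by (rule divide_right_mono) simp
  also have "\<dots> = card (commuting_pairs G N N) / ?n\<^sup>2 + (real (card ?P) - 1) / r"
    using n0 by (simp add: add_divide_distrib)
  also have "real (card ?P) = commuting_probability (G Mod N) * a\<^sup>2"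
    unfolding commuting_probability_eq R using a0 by (simp add: a_def)
  also have "card (commuting_pairs G N N) / ?n\<^sup>2 = commuting_probability (G\<lparr>carrier := N\<rparr>)"
    by (simp add: commuting_probability_subgroup)
  finally show ?thesis .
qed

text \<open>No commuting pair of cosets contributes more than the pair
  \<open>(N, N)\<close>.\<close>

theorem commuting_probability_le_mult:
  assumes N: "N \<lhd> G"
  shows "commuting_probability G \<le> commuting_probability (G\<lparr>carrier := N\<rparr>) * commuting_probability (G Mod N)"
proof -
  have S: "subgroup N G" using N by (rule normal_imp_subgroup)
  let ?R = "rcosets N" and ?n = "real (card N)"
  let ?P = "commuting_pairs (G Mod N) ?R ?R"
  define a where "a = real (card ?R)"
  have R: "carrier (G Mod N) = ?R" by (simp add: FactGroup_def)
  have NR: "N \<in> ?R" using S subgroup.subgroup_in_rcosets group_axioms by blast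
  have n0: "0 < ?n" using card_subgroup_pos[OF S] by simp
  have a0: "0 < a" unfolding a_def using NR finite_rcosets[OF S] card_gt_0_iff by fastforce
  have og: "real (card (carrier G)) = a * ?n"
    unfolding a_def using lagrange[OF S] by (metis of_nat_mult order_def)
  have "card (commuting_pairs G (carrier G) (carrier G)) \<le> (\<Sum>p\<in>?P. card (commuting_pairs G N N))"
    unfolding card_commuting_pairs_quotient[OF N] R
    using card_commuting_pairs_cosets[OF S]
    by (intro sum_mono) (auto simp: commuting_pairs_def[of "G Mod N"])
  then have *: "real (card (commuting_pairs G (carrier G) (carrier G)))
     \<le> real (card ?P) * real (card (commuting_pairs G N N))"
    by (metis of_nat_le_iff of_nat_mult sum_constant of_nat_id)
  have "commuting_probability G = real (card (commuting_pairs G (carrier G) (carrier G))) / (a * ?n)\<^sup>2"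
    unfolding commuting_probability_eq using og by simp
  also have "\<dots> \<le> (real (card ?P) * real (card (commuting_pairs G N N))) / (a * ?n)\<^sup>2"
    using * by (rule divide_right_mono) simp
  also have "\<dots> = commuting_probability (G\<lparr>carrier := N\<rparr>) * commuting_probability (G Mod N)"
    by (simp add: commuting_probability_eq[of "G Mod N"] commuting_probability_subgroup R a_def power_mult_distrib ac_simps)
  finally show ?thesis .
qed

lemma finite_group_subgroup: "subgroup H G \<Longrightarrow> finite_group (G\<lparr>carrier := H\<rparr>)"
  using subgroup_imp_group finite_subgroup
  by (simp add: finite_group_def finite_group_axioms_def)

lemma commuting_probability_mono:
  assumes "N \<lhd> G"
  shows "commuting_probability G \<le> commuting_probability (G\<lparr>carrier := N\<rparr>)"
    and "commuting_probability G \<le> commuting_probability (G Mod N)"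
proof -
  interpret A: finite_group "G\<lparr>carrier := N\<rparr>" using assms by (intro finite_group_subgroup normal_imp_subgroup)
  interpret B: finite_group "G Mod N" using assms by (rule finite_group_quotient)
  show "commuting_probability G \<le> commuting_probability (G\<lparr>carrier := N\<rparr>)"
    and "commuting_probability G \<le> commuting_probability (G Mod N)"
    using commuting_probability_le_mult[OF assms] A.commuting_probability_bounds
      B.commuting_probability_bounds
      mult_left_le[of "commuting_probability (G Mod N)" "commuting_probability (G\<lparr>carrier := N\<rparr>)"]
      mult_left_le_one_le[of "commuting_probability (G Mod N)" "commuting_probability (G\<lparr>carrier := N\<rparr>)"]
    by linarith+
qed

end

section \<open>Simple groups of odd order\<close>

context group
begin

lemma group_center_eq: "group_center G = {z \<in> carrier G. centralizer_in G (carrier G) z = carrier G}"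
  by (auto simp: group_center_def centralizer_in_def)

lemma group_center_normal: "group_center G \<lhd> G"
proof (rule normal_invI)
  show S: "subgroup (group_center G) G"
  proof (rule subgroupI)
    fix z assume z: "z \<in> group_center G"
    have "inv z \<otimes> x = x \<otimes> inv z" if x: "x \<in> carrier G" for x
    proof -
      have "z \<in> centralizer_in G (carrier G) x" using z x by (auto simp: group_center_def centralizer_in_def)
      then have "inv z \<in> centralizer_in G (carrier G) x"
        using subgroup_centralizer_in[OF subgroup_self x] by (rule subgroup.m_inv_closed[rotated])
      then show ?thesis by (simp add: centralizer_in_def)
    qed
    then show "inv z \<in> group_center G" using z by (auto simp: group_center_def)
  next
    fix y z assume yz: "y \<in> group_center G" "z \<in> group_center G"
    have "y \<otimes> z \<otimes> x = x \<otimes> (y \<otimes> z)" if x: "x \<in> carrier G" for x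
    proof -
      have "y \<in> centralizer_in G (carrier G) x" "z \<in> centralizer_in G (carrier G) x"
        using yz x by (auto simp: group_center_def centralizer_in_def)
      then have "y \<otimes> z \<in> centralizer_in G (carrier G) x"
        by (intro subgroup.m_closed[OF subgroup_centralizer_in[OF subgroup_self x]])
      then show ?thesis by (simp add: centralizer_in_def)
    qed
    moreover have "y \<otimes> z \<in> carrier G" using yz unfolding group_center_def by blast
    ultimately show "y \<otimes> z \<in> group_center G" unfolding group_center_def by blast
  next
    have "\<one> \<in> group_center G" by (simp add: group_center_def)
    then show "group_center G \<noteq> {}" by blast
  qed (auto simp: group_center_def)
  fix x h assume "x \<in> carrier G" "h \<in> group_center G"
  then have "x \<otimes> h \<otimes> inv x = h" by (auto simp: group_center_def inv_solve_right')
  then show "x \<otimes> h \<otimes> inv x \<in> group_center G" using \<open>h \<in> group_center G\<close> by simp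
qed

lemma card_conj_class:
  assumes "x \<in> carrier G"
  shows "card ((\<lambda>g. g \<otimes> x \<otimes> inv g) ` carrier G) * card (centralizer_in G (carrier G) x) = order G"
proof -
  interpret A: group_action G "carrier G" "\<lambda>g. \<lambda>h\<in>carrier G. g \<otimes> h \<otimes> inv g"
    by (rule action_by_conjugation)
  have "orbit G (\<lambda>g. \<lambda>h\<in>carrier G. g \<otimes> h \<otimes> inv g) x = (\<lambda>g. g \<otimes> x \<otimes> inv g) ` carrier G"
    using assms by (auto simp: orbit_def)
  moreover have "stabilizer G (\<lambda>g. \<lambda>h\<in>carrier G. g \<otimes> h \<otimes> inv g) x = centralizer_in G (carrier G) x"
    using assms by (auto simp: stabilizer_def centralizer_in_def inv_solve_right')
  ultimately show ?thesis using A.orbit_stabilizer_theorem[OF assms] by simp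
qed

lemma conj_class_eq:
  assumes "x \<in> carrier G" "g \<in> carrier G"
  shows "(\<lambda>h. h \<otimes> (g \<otimes> x \<otimes> inv g) \<otimes> inv h) ` carrier G = (\<lambda>h. h \<otimes> x \<otimes> inv h) ` carrier G"
proof -
  have "(\<lambda>h. h \<otimes> (g \<otimes> x \<otimes> inv g) \<otimes> inv h) ` carrier G
     = (\<lambda>h. h \<otimes> x \<otimes> inv h) ` (\<lambda>h. h \<otimes> g) ` carrier G"
    unfolding image_image using assms by (intro image_cong) (auto simp: word_simps)
  also have "(\<lambda>h. h \<otimes> g) ` carrier G = carrier G"
  proof
    show "carrier G \<subseteq> (\<lambda>h. h \<otimes> g) ` carrier G"
    proof
      fix h assume "h \<in> carrier G"
      then show "h \<in> (\<lambda>h. h \<otimes> g) ` carrier G"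
        using assms by (intro image_eqI[of _ _ "h \<otimes> inv g"]) (auto simp: m_assoc)
    qed
  qed (use assms in auto)
  finally show ?thesis .
qed

end

section \<open>Bounds from class sizes and centralizer orders\<close>

context finite_group
begin

text \<open>\<open>N - {\<one>}\<close> is a disjoint union of conjugacy classes of
  \<open>G\<close>; by orbit-stabilizer, the hypothesis says that each of them has \<open>a\<close>
  elements.\<close>

lemma dvd_card_normal_minus_1:
  assumes N: "N \<lhd> G"
    and a: "\<And>x. x \<in> N - {\<one>} \<Longrightarrow> a * card (centralizer_in G (carrier G) x) = order G"
  shows "a dvd card N - 1"
proof -
  have S: "subgroup N G" using N by (rule normal_imp_subgroup)
  note [simp] = subgroup.mem_carrier[OF S]
  let ?cl = "\<lambda>x. (\<lambda>g. g \<otimes> x \<otimes> inv g) ` carrier G"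
  let ?C = "?cl ` (N - {\<one>})"
  have U: "\<Union> ?C = N - {\<one>}"
  proof
    show "\<Union> ?C \<subseteq> N - {\<one>}" using normal_invE(2)[OF N] by (auto simp: inv_solve_right')
    show "N - {\<one>} \<subseteq> \<Union> ?C"
    proof
      fix x assume "x \<in> N - {\<one>}"
      moreover from this have "x \<in> ?cl x" by (intro image_eqI[of _ _ \<one>]) auto
      ultimately show "x \<in> \<Union> ?C" by blast
    qed
  qed
  have fN: "finite N" using S by (rule finite_subgroup)
  have "a * card ?C = card (\<Union> ?C)"
  proof (rule card_partition)
    fix c assume "c \<in> ?C"
    then obtain x where x: "x \<in> N - {\<one>}" "c = ?cl x" by blast
    have "card c * card (centralizer_in G (carrier G) x) = order G"
      unfolding x(2) using x(1) by (intro card_conj_class) auto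
    moreover have "0 < card (centralizer_in G (carrier G) x)"
      using x(1) by (intro card_subgroup_pos subgroup_centralizer_in subgroup_self) auto
    ultimately show "card c = a" using a[OF x(1)] by (metis mult_right_cancel neq0_conv)
  next
    fix c d assume cd: "c \<in> ?C" "d \<in> ?C" "c \<noteq> d"
    obtain x where x: "x \<in> N - {\<one>}" "c = ?cl x" using cd(1) by blast
    obtain y where y: "y \<in> N - {\<one>}" "d = ?cl y" using cd(2) by blast
    note xy = x(2) y(2)
    show "c \<inter> d = {}"
    proof (rule ccontr)
      assume "c \<inter> d \<noteq> {}"
      then obtain g h where gh: "g \<in> carrier G" "h \<in> carrier G" "g \<otimes> x \<otimes> inv g = h \<otimes> y \<otimes> inv h"
        unfolding xy by auto
      then have "c = d" unfolding xy
        using conj_class_eq[OF _ gh(1), of x] conj_class_eq[OF _ gh(2), of y] x y by simp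
      with cd show False by simp
    qed
  next
    show "finite ?C" using fN by simp
    show "finite (\<Union> ?C)" unfolding U using fN by simp
  qed
  also have "card (\<Union> ?C) = card N - 1"
    unfolding U using subgroup.one_closed[OF S] by simp
  finally show ?thesis by (rule dvdI[OF sym])
qed

text \<open>Elements of \<open>S\<close> are counted with the whole group as centralizer, the others
  with at most one \<open>r\<close>-th of it. In the applications \<open>S\<close> is the
  center.\<close>

lemma commuting_probability_le_centralizers:
  assumes S: "S \<subseteq> carrier G" and "0 < r"
    and r: "\<And>x. x \<in> carrier G - S \<Longrightarrow> r * card (centralizer_in G (carrier G) x) \<le> order G"
  shows "commuting_probability G \<le> card S / order G + (1 - card S / order G) / r"
proof -
  let ?c = "\<lambda>x. card (centralizer_in G (carrier G) x)" and ?g = "real (order G)"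
  have fS: "finite S" using S fin finite_subset by blast
  have g: "0 < ?g" using fin order_gt_0_iff_finite by simp
  have "card (commuting_pairs G (carrier G) (carrier G)) = (\<Sum>x\<in>carrier G. ?c x)"
    using fin by (intro card_commuting_pairs)
  also have "\<dots> = (\<Sum>x\<in>carrier G - S. ?c x) + (\<Sum>x\<in>S. ?c x)"
    using S fin by (rule sum.subset_diff)
  finally have "real (card (commuting_pairs G (carrier G) (carrier G)))
    = (\<Sum>x\<in>carrier G - S. real (?c x)) + (\<Sum>x\<in>S. real (?c x))" by simp
  also have "(\<Sum>x\<in>carrier G - S. real (?c x)) \<le> (\<Sum>x\<in>carrier G - S. ?g / r)"
  proof (rule sum_mono)
    fix x assume "x \<in> carrier G - S"
    then have "real (r * ?c x) \<le> ?g" using r of_nat_le_iff by blast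
    then show "real (?c x) \<le> ?g / r" using \<open>0 < r\<close> by (simp add: field_simps)
  qed
  also have "(\<Sum>x\<in>carrier G - S. ?g / r) = (?g - card S) * (?g / r)"
    using S fS fin card_mono[OF fin S] by (simp add: card_Diff_subset order_def of_nat_diff)
  also have "(\<Sum>x\<in>S. real (?c x)) \<le> (\<Sum>x\<in>S. ?g)"
    by (intro sum_mono) (auto simp: order_def centralizer_in_def intro!: card_mono fin)
  finally have "real (card (commuting_pairs G (carrier G) (carrier G))) \<le> (?g - card S) * (?g / r) + card S * ?g"
    by simp
  then have "commuting_probability G \<le> ((?g - card S) * (?g / r) + card S * ?g) / ?g\<^sup>2"
    unfolding commuting_probability_eq order_def of_nat_power by (intro divide_right_mono) simp_all
  also have "\<dots> = card S / order G + (1 - card S / order G) / r"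
    using g \<open>0 < r\<close> by (simp add: field_simps power2_eq_square)
  finally show ?thesis .
qed

end

context odd_group
begin

lemma odd_group_subgroup: "subgroup H G \<Longrightarrow> odd_group (G\<lparr>carrier := H\<rparr>)"
  using finite_group_subgroup odd_card_subgroup
  by (simp add: odd_group_def odd_group_axioms_def order_def)

lemma odd_group_quotient:
  assumes "N \<lhd> G"
  shows "odd_group (G Mod N)"
proof -
  have "card (rcosets N) * card N = order G"
    using lagrange[OF normal_imp_subgroup[OF assms]] .
  then have "odd (card (rcosets N))" using odd by (metis even_mult_iff)
  then show ?thesis using finite_group_quotient[OF assms]
    by (simp add: odd_group_def odd_group_axioms_def order_def FactGroup_def)
qed

lemma centralizer_proper:
  assumes "x \<in> carrier G" "x \<notin> group_center G"
  shows "3 * card (centralizer_in G (carrier G) x) \<le> order G"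
  unfolding order_def
  using assms by (intro card_proper_subgroup subgroup_centralizer_in subgroup_self)
    (auto simp: group_center_eq centralizer_in_def)

text \<open>For a noncentral \<open>x\<close>, the center, the centralizer of \<open>x\<close> and
  \<open>G\<close> form a strict chain with both indices at least 3, so the center has index at
  least 9. Then 11/27 is 1/9 + (8/9)/3.\<close>

lemma nonabelian_bounds:
  assumes "\<not> comm_group G"
  shows "commuting_probability G \<le> 11 / 27" and "9 \<le> order G"
proof -
  let ?Z = "group_center G" and ?g = "order G"
  have Z: "subgroup ?Z G" using group_center_normal by (rule normal_imp_subgroup)
  obtain x where x: "x \<in> carrier G" "centralizer_in G (carrier G) x \<noteq> carrier G"
    using assms comm_group_iff by blast
  then have xZ: "x \<notin> ?Z" by (simp add: group_center_eq)
  have "?Z \<subset> centralizer_in G (carrier G) x"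
    using x xZ by (auto simp: group_center_def centralizer_in_def)
  then have "3 * card ?Z \<le> card (centralizer_in G (carrier G) x)"
    using x by (intro card_proper_subgroup Z subgroup_centralizer_in subgroup_self)
  with centralizer_proper[OF x(1) xZ] have *: "9 * card ?Z \<le> ?g" by simp
  then show "9 \<le> ?g" using card_subgroup_pos[OF Z] by simp
  have z: "card ?Z / ?g \<le> 1 / 9" using * \<open>9 \<le> ?g\<close> by (simp add: field_simps)
  have "commuting_probability G \<le> card ?Z / ?g + (1 - card ?Z / ?g) / real 3"
    using subgroup.subset[OF Z] centralizer_proper
    by (intro commuting_probability_le_centralizers) auto
  then have "commuting_probability G \<le> card ?Z / ?g + (1 - card ?Z / ?g) / 3" by simp
  moreover have "z + (1 - z) / 3 \<le> 11 / 27" if "z \<le> 1 / 9" for z :: real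
    using that by (simp add: diff_divide_distrib)
  ultimately show "commuting_probability G \<le> 11 / 27" using z order_trans by blast
qed

lemma normal_of_conj_eq:
  assumes "subgroup H G" "\<And>g. g \<in> carrier G \<Longrightarrow> conj_set g H = H"
  shows "H \<lhd> G"
  using assms by (intro normal_invI) (auto simp: conj_set_def)

lemma subgroup_conj_stabilizer:
  assumes J: "J \<subseteq> carrier G"
  shows "subgroup {g \<in> carrier G. conj_set g J = J} G"
proof (rule subgroupI)
  have comp: "conj_set (g \<otimes> h) J = conj_set g (conj_set h J)" if "g \<in> carrier G" "h \<in> carrier G" for g h
    unfolding conj_set_def image_image using that J by (intro image_cong) (auto simp: word_simps subset_iff)
  have one: "conj_set \<one> J = J" unfolding conj_set_def using J by (force simp: subset_iff)
  show "{g \<in> carrier G. conj_set g J = J} \<noteq> {}" using one by blast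
  fix g assume g: "g \<in> {g \<in> carrier G. conj_set g J = J}"
  then have "conj_set (inv g) J = conj_set (inv g) (conj_set g J)" by simp
  also have "\<dots> = J" using g comp[of "inv g" g] one by simp
  finally show "inv g \<in> {g \<in> carrier G. conj_set g J = J}" using g by simp
  fix h assume h: "h \<in> {g \<in> carrier G. conj_set g J = J}"
  with g comp[of g h] show "g \<otimes> h \<in> {g \<in> carrier G. conj_set g J = J}" by simp
qed auto

text \<open>Class sizes 3 and 5 would give normal centralizers. If \<open>H\<close> is a centralizer of index 7, some
  conjugate \<open>H'\<close> meets it in a subgroup \<open>J\<close> of index 3 in both, so \<open>J\<close> is normalized by more than
  \<open>H\<close>, hence by \<open>G\<close>; then \<open>J\<close> is trivial, the order is 21 and all nontrivial classes have size 7,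
  which does not divide 20. So all nontrivial classes have at least 9 elements.\<close>

lemma simple_commuting_probability_le:
  assumes simple: "\<And>N. N \<lhd> G \<Longrightarrow> N = {\<one>} \<or> N = carrier G" and nc: "\<not> comm_group G"
  shows "commuting_probability G \<le> 35 / 243"
proof -
  let ?C = "centralizer_in G (carrier G)"
  have "group_center G \<noteq> carrier G" using nc by (auto simp: comm_group_iff group_center_eq)
  then have Z: "group_center G = {\<one>}" using simple[OF group_center_normal] by simp
  have sC: "subgroup (?C x) G" if "x \<in> carrier G" for x
    using that by (intro subgroup_centralizer_in subgroup_self)
  have C: "x \<in> ?C x" "?C x \<noteq> carrier G" if "x \<in> carrier G - {\<one>}" for x
    using that Z by (auto simp: group_center_eq centralizer_in_def)
  have C3: "3 \<le> card (?C x)" if "x \<in> carrier G - {\<one>}" for x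
  proof -
    have s: "subgroup (?C x) G" using that by (intro sC) auto
    have "{\<one>} \<subset> ?C x" using C(1)[OF that] that subgroup.one_closed[OF s] by auto
    then show ?thesis using card_proper_subgroup[OF triv_subgroup s] by simp
  qed
  have nn: "\<not> ?C x \<lhd> G" if "x \<in> carrier G - {\<one>}" for x
    using simple[of "?C x"] C[OF that] that by auto
  have index: "\<exists>m. order G = m * card (?C x) \<and> odd m \<and> 7 \<le> m" if x: "x \<in> carrier G - {\<one>}" for x
  proof -
    have s: "subgroup (?C x) G" using x by (intro sC) auto
    obtain m where m: "order G = m * card (?C x)" using lagrange[OF s] by metis
    have "7 \<le> m"
    proof (rule ccontr)
      assume "\<not> 7 \<le> m"
      then have "?C x \<lhd> G"
        using m s by (intro normal_of_conj_eq small_index_conj[of _ "carrier G" _ m])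
          (auto intro: subgroup_self simp: order_def centralizer_in_def)
      with nn[OF x] show False ..
    qed
    moreover have "odd m" using m odd by simp
    ultimately show ?thesis using m by blast
  qed
  show ?thesis
  proof (cases "\<exists>x \<in> carrier G - {\<one>}. order G = 7 * card (?C x)")
    case True
    then obtain x where x: "x \<in> carrier G - {\<one>}" "order G = 7 * card (?C x)" by blast
    define H where "H = ?C x"
    have H: "subgroup H G" unfolding H_def using x(1) by (intro sC) auto
    have g7: "order G = 7 * card H" using x by (simp add: H_def)
    obtain h where h: "h \<in> carrier G" "conj_set h H \<noteq> H"
      using nn[OF x(1)] normal_of_conj_eq[OF H] unfolding H_def by blast
    let ?H' = "conj_set h H"
    have H': "subgroup ?H' G" using h H by (intro subgroup_conj)
    have cH': "card ?H' = card H" using h(1) subgroup.subset[OF H] by (rule card_conj)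
    define J where "J = H \<inter> ?H'"
    have J: "subgroup J G" unfolding J_def using H H' by (rule subgroups_Inter_pair)
    \<comment> \<open>\<open>k\<close> is the index of \<open>J\<close> in \<open>H\<close>; the two
      inequalities leave only 3, and a subgroup of index 3 is invariant under conjugation by
      \<open>H\<close> and likewise by \<open>?H'\<close>.\<close>
    obtain k where k: "3 \<le> k" "2 * k + 1 \<le> 7" "card H = k * card J"
      unfolding J_def using conj_index[OF H subgroup_self subgroup.subset[OF H] h(1) _ h(2)] g7
      by (metis order_def)
    then have k3: "card H = 3 * card J" by simp
    have HJ: "conj_set g J = J" if "g \<in> H" for g
      using that k3 by (intro small_index_conj[OF J H _ that]) (auto simp: J_def)
    have H'J: "conj_set g J = J" if "g \<in> ?H'" for g
      using that k3 cH' by (intro small_index_conj[OF J H' _ that]) (auto simp: J_def)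
    define N where "N = {g \<in> carrier G. conj_set g J = J}"
    have N: "subgroup N G" unfolding N_def using subgroup.subset[OF J] by (rule subgroup_conj_stabilizer)
    have HN: "H \<subseteq> N" using HJ subgroup.subset[OF H] by (auto simp: N_def)
    have H'N: "?H' \<subseteq> N" using H'J subgroup.subset[OF H'] by (auto simp: N_def)
    have "H \<noteq> N"
    proof
      assume "H = N"
      then have "?H' = H" using H'N cH' finite_subgroup[OF H] by (intro card_subset_eq) auto
      with h show False by simp
    qed
    then have "3 * card H \<le> card N" using HN by (intro card_proper_subgroup H N) auto
    \<comment> \<open>The index of \<open>N\<close> is at most 7/3, hence below 3.\<close>
    then have "N = carrier G" using g7 card_subgroup_pos[OF H] by (intro subgroup_eq_carrier N) simp
    then have "J \<lhd> G" unfolding N_def by (intro normal_of_conj_eq J) blast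
    moreover have "J \<noteq> carrier G" using C(2)[OF x(1)] subgroup.subset[OF H] unfolding J_def H_def by blast
    ultimately have "J = {\<one>}" using simple by blast
    then have g21: "order G = 21" using g7 k3 by simp
    have "7 dvd card (carrier G) - 1"
    proof (rule dvd_card_normal_minus_1[OF normal_self])
      fix y assume y: "y \<in> carrier G - {\<one>}"
      then obtain m where m: "order G = m * card (?C y)" "7 \<le> m" using index by blast
      \<comment> \<open>In order 21 a centralizer with at least 3 elements has index at most 7,
        which meets the lower bound on \<open>m\<close>.\<close>
      have "m * 3 \<le> 21" using m C3[OF y] g21 by (metis mult_le_mono2)
      then show "7 * card (?C y) = order G" using m by simp
    qed
    then show ?thesis using g21 by (simp add: order_def)
  next
    case False
    have r: "9 * card (?C x) \<le> order G" if x: "x \<in> carrier G - {\<one>}" for x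
    proof -
      obtain m where m: "order G = m * card (?C x)" "odd m" "7 \<le> m" using index[OF x] by blast
      then have "m \<noteq> 7" using False x by blast
      moreover have "m \<noteq> 8" using m(2) by auto
      ultimately have "9 \<le> m" using m(3) by simp
      then show ?thesis using m(1) by simp
    qed
    have "carrier G \<noteq> {\<one>}" using nc comm_group_iff by (auto simp: centralizer_in_def)
    then obtain x where "x \<in> carrier G - {\<one>}" using one_closed by blast
    then have g: "27 \<le> order G" using r[of x] C3[of x] by simp
    have "commuting_probability G \<le> card {\<one>} / order G + (1 - card {\<one>} / order G) / real 9"
      using r by (intro commuting_probability_le_centralizers) auto
    also have "\<dots> = 1 / 9 + 8 / 9 / order G" by (simp add: field_simps)
    \<comment> \<open>This is the source of 35/243 = 27/243 + 8/243. The order is at least 27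
      because a nontrivial element has a centralizer of order at least 3 and index at least
      9.\<close>
    also have "\<dots> \<le> 1 / 9 + 8 / 9 / 27" using g by (intro add_left_mono divide_left_mono) auto
    finally show ?thesis by simp
  qed
qed

end

section \<open>Minimal normal subgroups\<close>

context group
begin

lemma derived_subset:
  assumes "subgroup K G" "\<And>x y. x \<in> H \<Longrightarrow> y \<in> H \<Longrightarrow> x \<otimes> y \<otimes> inv x \<otimes> inv y \<in> K"
  shows "derived G H \<subseteq> K"
  unfolding derived_def using assms by (intro generate_subgroup_incl) auto

lemma derived_memI:
  assumes "x \<in> H" "y \<in> H"
  shows "x \<otimes> y \<otimes> inv x \<otimes> inv y \<in> derived G H"
  unfolding derived_def using assms by (intro generate.incl) blast

lemma quotient_commute:
  assumes K: "K \<lhd> G" and Q: "comm_group (G Mod K)" and xy: "x \<in> carrier G" "y \<in> carrier G"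
  shows "x \<otimes> y \<otimes> inv x \<otimes> inv y \<in> K"
proof -
  interpret K: normal K G by fact
  interpret Q: comm_group "G Mod K" by fact
  have "K #> x \<in> carrier (G Mod K)" "K #> y \<in> carrier (G Mod K)"
    using xy by (auto simp: carrier_FactGroup)
  from Q.m_comm[OF this] have "K #> (x \<otimes> y) = K #> (y \<otimes> x)"
    using xy by (simp add: K.rcos_sum)
  moreover have "x \<otimes> y \<in> K #> (x \<otimes> y)" using xy by (intro rcos_self K.subgroup_axioms) auto
  ultimately have "x \<otimes> y \<otimes> inv (y \<otimes> x) \<in> K"
    using K.rcos_module_imp[OF group_axioms, of "y \<otimes> x" "x \<otimes> y"] xy by simp
  then show ?thesis using xy by (simp add: word_simps)
qed

text \<open>The correspondence theorem. As a set, \<open>P\<close> is the union of the cosets in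
  \<open>L\<close>, which gives the count.\<close>

lemma quotient_normal_preimage:
  assumes K: "K \<lhd> G" and L: "L \<lhd> (G Mod K)"
  defines "P \<equiv> {x \<in> carrier G. K #> x \<in> L}"
  shows "P \<lhd> G" and "K \<subseteq> P" and "L = (#>) K ` P" and "card P = card L * card K"
proof -
  interpret K: normal K G by fact
  interpret L: normal L "G Mod K" by fact
  have sub: "L \<subseteq> rcosets K" using L.subset by (simp add: FactGroup_def)
  have inv: "K #> inv x \<in> L" if "x \<in> carrier G" "K #> x \<in> L" for x
  proof -
    have "K #> x \<in> carrier (G Mod K)" using that by (auto simp: carrier_FactGroup)
    then have "inv\<^bsub>G Mod K\<^esub> (K #> x) = K #> inv x"
      using that(1) by (simp add: K.inv_FactGroup K.rcos_inv)
    then show ?thesis using subgroup.m_inv_closed[OF L.subgroup_axioms that(2)] by simp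
  qed
  have mult: "K #> (x \<otimes> y) \<in> L" if "x \<in> carrier G" "K #> x \<in> L" "y \<in> carrier G" "K #> y \<in> L" for x y
    using subgroup.m_closed[OF L.subgroup_axioms that(2,4)] that by (simp add: K.rcos_sum)
  show "P \<lhd> G"
  proof (rule normal_invI)
    show "subgroup P G"
    proof (rule subgroupI)
      have "\<one> \<in> P" using subgroup.one_closed[OF L.subgroup_axioms] K.subset by (simp add: P_def)
      then show "P \<noteq> {}" by blast
    qed (auto simp: P_def inv mult)
    fix x h assume x: "x \<in> carrier G" "h \<in> P"
    have "K #> x \<in> carrier (G Mod K)" using x by (auto simp: carrier_FactGroup)
    moreover have "inv\<^bsub>G Mod K\<^esub> (K #> x) = K #> inv x"
      using x(1) K.inv_FactGroup[OF calculation] K.rcos_inv by simp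
    ultimately have "K #> (x \<otimes> h \<otimes> inv x) \<in> L"
      using L.inv_op_closed2[of "K #> x" "K #> h"] x by (simp add: P_def K.rcos_sum)
    then show "x \<otimes> h \<otimes> inv x \<in> P" using x by (simp add: P_def)
  qed
  show "K \<subseteq> P"
    using subgroup.one_closed[OF L.subgroup_axioms] K.subset K.rcos_const[OF group_axioms] by (auto simp: P_def)
  show L: "L = (#>) K ` P" using sub by (auto simp: P_def RCOSETS_def)
  have P: "P = \<Union> L"
  proof
    show "P \<subseteq> \<Union> L" using rcos_self[OF _ K.subgroup_axioms] by (auto simp: P_def)
    show "\<Union> L \<subseteq> P"
    proof
      fix x assume "x \<in> \<Union> L"
      then obtain y where y: "y \<in> carrier G" "K #> y \<in> L" "x \<in> K #> y" using sub by (auto simp: RCOSETS_def)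
      then have "K #> y = K #> x" using repr_independence K.subgroup_axioms by blast
      moreover have "x \<in> carrier G" using y r_coset_subset_G K.subset by blast
      ultimately show "x \<in> P" using y by (simp add: P_def)
    qed
  qed
  show "card P = card L * card K"
  proof (cases "finite P")
    case True
    have "card K * card L = card (\<Union> L)"
    proof (rule card_partition)
      show "finite L" unfolding L using True by simp
      show "finite (\<Union> L)" using True P by simp
      show "card c = card K" if "c \<in> L" for c
        using that sub card_rcosets_equal K.subset by auto
      show "c \<inter> d = {}" if "c \<in> L" "d \<in> L" "c \<noteq> d" for c d
        using that sub rcos_disjoint[OF K.subgroup_axioms] by (auto simp: pairwise_def disjnt_def)
    qed
    then show ?thesis using P by (simp add: mult.commute)
  next
    case False
    \<comment> \<open>\<open>card\<close> is 0 on infinite sets, so both sides vanish once one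
      factor is infinite.\<close>
    have "infinite K \<or> infinite L"
    proof (rule ccontr)
      assume "\<not> (infinite K \<or> infinite L)"
      moreover have "finite c" if "c \<in> L" "finite K" for c
        using that sub by (auto simp: RCOSETS_def r_coset_def)
      ultimately have "finite (\<Union> L)" by blast
      with False P show False by simp
    qed
    with False show ?thesis by auto
  qed
qed

end

context finite_group
begin

lemma ex_maximal_normal:
  assumes "P N0" "N0 \<lhd> G"
  obtains K where "K \<lhd> G" "P K" "\<And>N. N \<lhd> G \<Longrightarrow> P N \<Longrightarrow> K \<subseteq> N \<Longrightarrow> N = K"
proof -
  let ?A = "{N. N \<lhd> G \<and> P N}"
  have "?A \<subseteq> Pow (carrier G)" using normal_imp_subgroup subgroup.subset by blast
  then have "finite ?A" using fin finite_subset by blast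
  moreover have "?A \<noteq> {}" using assms by blast
  ultimately obtain K where "K \<in> ?A" "\<forall>N\<in>?A. K \<subseteq> N \<longrightarrow> K = N"
    using finite_has_maximal[of ?A] by blast
  then show thesis using that by blast
qed

lemma ex_minimal_normal:
  assumes "P N0" "N0 \<lhd> G"
  obtains K where "K \<lhd> G" "P K" "\<And>N. N \<lhd> G \<Longrightarrow> P N \<Longrightarrow> N \<subseteq> K \<Longrightarrow> N = K"
proof -
  let ?A = "{N. N \<lhd> G \<and> P N}"
  have "?A \<subseteq> Pow (carrier G)" using normal_imp_subgroup subgroup.subset by blast
  then have "finite ?A" using fin finite_subset by blast
  moreover have "?A \<noteq> {}" using assms by blast
  ultimately obtain K where "K \<in> ?A" "\<forall>N\<in>?A. N \<subseteq> K \<longrightarrow> K = N"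
    using finite_has_minimal[of ?A] by blast
  then show thesis using that by blast
qed

end

context odd_group
begin

text \<open>The quotient by a maximal normal subgroup is simple, and nonabelian since
  \<open>G\<close> is perfect. Its commuting probability is at least that of \<open>G\<close>,
  contrary to the bound for simple groups.\<close>

lemma perfect_imp_trivial:
  assumes d: "35 / 243 < commuting_probability G" and perfect: "derived G (carrier G) = carrier G"
  shows "carrier G = {\<one>}"
proof (rule ccontr)
  assume "carrier G \<noteq> {\<one>}"
  then obtain K where K: "K \<lhd> G" "K \<noteq> carrier G"
    and max: "\<And>N. N \<lhd> G \<Longrightarrow> N \<noteq> carrier G \<Longrightarrow> K \<subseteq> N \<Longrightarrow> N = K"
    using ex_maximal_normal[of "\<lambda>N. N \<noteq> carrier G" "{\<one>}"] one_is_normal by metis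
  interpret S: odd_group "G Mod K" using K(1) by (rule odd_group_quotient)
  have "\<not> comm_group (G Mod K)"
  proof
    assume "comm_group (G Mod K)"
    then have "derived G (carrier G) \<subseteq> K"
      using K(1) by (intro derived_subset quotient_commute normal_imp_subgroup)
    with perfect K show False using normal_imp_subgroup subgroup.subset by blast
  qed
  moreover have "L = {\<one>\<^bsub>G Mod K\<^esub>} \<or> L = carrier (G Mod K)" if L: "L \<lhd> (G Mod K)" for L
  proof -
    let ?P = "{x \<in> carrier G. K #> x \<in> L}"
    note P = quotient_normal_preimage[OF K(1) L]
    consider "?P = carrier G" | "?P = K" using max[OF P(1) _ P(2)] by blast
    then show ?thesis
    proof cases
      case 1
      then show ?thesis using P(3) by (simp add: carrier_FactGroup)
    next
      case 2
      have "K #> x = K" if "x \<in> K" for x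
        using normal_imp_subgroup[OF K(1)] group_axioms that by (rule subgroup.rcos_const)
      moreover have "\<one> \<in> K" using normal_imp_subgroup[OF K(1)] by (rule subgroup.one_closed)
      ultimately have "(#>) K ` K = {K}" by blast
      then show ?thesis using P(3) 2 by simp
    qed
  qed
  ultimately have "commuting_probability (G Mod K) \<le> 35 / 243"
    by (intro S.simple_commuting_probability_le)
  with d commuting_probability_mono(2)[OF K(1)] show False by simp
qed

text \<open>The derived subgroup of \<open>N\<close> is normal in \<open>G\<close>, so by minimality
  it is trivial or all of \<open>N\<close>. In the second case \<open>N\<close> is perfect, and its
  commuting probability is again too large.\<close>

lemma minimal_normal_abelian:
  assumes d: "35 / 243 < commuting_probability G" and N: "N \<lhd> G" "N \<noteq> {\<one>}"
    and min: "\<And>M. M \<lhd> G \<Longrightarrow> M \<subseteq> N \<Longrightarrow> M = {\<one>} \<or> M = N"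
    and xy: "x \<in> N" "y \<in> N"
  shows "x \<otimes> y = y \<otimes> x"
proof -
  have S: "subgroup N G" using N(1) by (rule normal_imp_subgroup)
  have "derived G N \<noteq> N"
  proof
    assume *: "derived G N = N"
    interpret N: odd_group "G\<lparr>carrier := N\<rparr>" using S by (rule odd_group_subgroup)
    have "carrier (G\<lparr>carrier := N\<rparr>) = {\<one>\<^bsub>G\<lparr>carrier := N\<rparr>\<^esub>}"
    proof (rule N.perfect_imp_trivial)
      show "35 / 243 < commuting_probability (G\<lparr>carrier := N\<rparr>)"
        using d commuting_probability_mono(1)[OF N(1)] by simp
      show "derived (G\<lparr>carrier := N\<rparr>) (carrier (G\<lparr>carrier := N\<rparr>)) = carrier (G\<lparr>carrier := N\<rparr>)"
        using derived_consistent[OF _ S, of N] * by simp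
    qed
    with N show False by simp
  qed
  moreover have "derived G N \<subseteq> N" using derived_incl[OF _ S] by simp
  ultimately have "derived G N = {\<one>}" using min[OF derived_is_normal[OF N(1)]] by blast
  then have "x \<otimes> y \<otimes> inv x \<otimes> inv y = \<one>" using derived_memI[OF xy] by simp
  then show ?thesis using xy subgroup.mem_carrier[OF S] by (simp add: mult_eq_commute_iff)
qed

text \<open>With \<open>C\<close> the centralizer of \<open>N\<close> and \<open>a\<close> its index: if \<open>G Mod C\<close> is not abelian, the counting
  bound with \<open>r = 3\<close> contradicts \<open>d\<close> as soon as \<open>a \<ge> 9\<close>. If it is abelian, then \<open>G Mod C\<close> acts
  without fixed points on \<open>N\<close>, whence \<open>2 a\<close> divides \<open>card N - 1\<close>, and the bound with \<open>r = card N\<close>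
  leaves only \<open>a = 3\<close> and \<open>card N = 25\<close>.\<close>

theorem minimal_normal_noncyclic:
  assumes d: "35 / 243 < commuting_probability G" and N: "N \<lhd> G" "N \<noteq> {\<one>}"
    and min: "\<And>M. M \<lhd> G \<Longrightarrow> M \<subseteq> N \<Longrightarrow> M = {\<one>} \<or> M = N"
    and nc: "\<And>x. x \<in> N \<Longrightarrow> generate G {x} \<noteq> N"
  obtains C where "C \<lhd> G" "N \<subseteq> C" "order G = 3 * card C" "card N = 25"
    "\<And>x. x \<in> carrier G - C \<Longrightarrow> centralizer_in G N x = {\<one>}"
proof -
  have S: "subgroup N G" using N(1) by (rule normal_imp_subgroup)
  note [simp] = subgroup.mem_carrier[OF S]
  have ab: "x \<otimes> y = y \<otimes> x" if "x \<in> N" "y \<in> N" for x y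
    using d N min that by (rule minimal_normal_abelian)
  define C where "C = {g \<in> carrier G. \<forall>n\<in>N. n \<otimes> g = g \<otimes> n}"
  have Cc: "g \<in> C \<longleftrightarrow> g \<in> carrier G \<and> (\<forall>n\<in>N. g \<in> centralizer_in G (carrier G) n)" for g
    by (auto simp: C_def centralizer_in_def)
  note sub_cent = subgroup_centralizer_in[OF subgroup_self, of n for n]
  have CG: "C \<lhd> G"
  proof (rule normal_invI)
    show "subgroup C G"
    proof (rule subgroupI)
      have "\<one> \<in> C" by (simp add: C_def)
      then show "C \<noteq> {}" by blast
      show "inv g \<in> C" if "g \<in> C" for g
        using that subgroup.m_inv_closed[OF sub_cent] by (simp add: Cc)
      show "g \<otimes> h \<in> C" if "g \<in> C" "h \<in> C" for g h
        using that subgroup.m_closed[OF sub_cent] by (simp add: Cc)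
    qed (simp add: C_def)
    fix x g assume x: "x \<in> carrier G" and g: "g \<in> C"
    have gc: "g \<in> carrier G" using g by (simp add: C_def)
    have "n \<otimes> (x \<otimes> g \<otimes> inv x) = x \<otimes> g \<otimes> inv x \<otimes> n" if n: "n \<in> N" for n
    proof -
      have "inv x \<otimes> n \<otimes> x \<in> N" using N(1) x n by (rule normal.inv_op_closed1)
      then have "(inv x \<otimes> n \<otimes> x) \<otimes> g = g \<otimes> (inv x \<otimes> n \<otimes> x)" using g by (auto simp: C_def)
      then have "x \<otimes> ((inv x \<otimes> n \<otimes> x) \<otimes> g) \<otimes> inv x = x \<otimes> (g \<otimes> (inv x \<otimes> n \<otimes> x)) \<otimes> inv x" by simp
      then show ?thesis using x n gc by (simp add: word_simps)
    qed
    then show "x \<otimes> g \<otimes> inv x \<in> C" using x gc by (simp add: C_def)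
  qed
  have C: "subgroup C G" using CG by (rule normal_imp_subgroup)
  have NC: "N \<subseteq> C" using ab by (auto simp: C_def)
  define a where "a = card (rcosets C)"
  have oa: "order G = a * card C" unfolding a_def using lagrange[OF C] by simp
  have odda: "odd a" using oa odd by simp
  interpret A: odd_group "G Mod C" using CG by (rule odd_group_quotient)
  interpret CC: finite_group "G\<lparr>carrier := C\<rparr>" using C by (rule finite_group_subgroup)
  have oA: "order (G Mod C) = a" by (simp add: order_def a_def FactGroup_def)
  have C3: "3 * card (centralizer_in G C x) \<le> card C" if x: "x \<in> carrier G - C" for x
  proof (rule card_proper_subgroup)
    obtain n where "n \<in> N" "n \<otimes> x \<noteq> x \<otimes> n" using x by (auto simp: C_def)
    then have "n \<in> C - centralizer_in G C x" using NC by (auto simp: centralizer_in_def)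
    then show "centralizer_in G C x \<subset> C" by (auto simp: centralizer_in_def)
  qed (use x C in \<open>auto intro: subgroup_centralizer_in\<close>)
  show thesis
  proof (cases "comm_group (G Mod C)")
    case False
    note A = A.nonabelian_bounds[OF False, unfolded oA]
    have "commuting_probability G * (real a)\<^sup>2 \<le> commuting_probability (G\<lparr>carrier := C\<rparr>)
        + (commuting_probability (G Mod C) * (real a)\<^sup>2 - 1) / real 3"
      unfolding a_def using C3 by (intro commuting_probability_quotient_bound CG) auto
    also have "\<dots> \<le> 1 + (11 / 27 * (real a)\<^sup>2 - 1) / real 3"
      using A CC.commuting_probability_bounds(2)
      by (intro add_mono divide_right_mono diff_mono mult_right_mono) auto
    finally have "commuting_probability G * (real a)\<^sup>2 \<le> 2 / 3 + 11 / 81 * (real a)\<^sup>2"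
      by (simp add: diff_divide_distrib)
    moreover have "35 / 243 * (real a)\<^sup>2 < commuting_probability G * (real a)\<^sup>2"
      using d A(2) by (intro mult_strict_right_mono) auto
    \<comment> \<open>35/243 - 11/81 = 2/243, and 81 times this is 2/3: from \<open>a = 9\<close>
      on, the lower bound has caught up with the upper one.\<close>
    moreover have "9\<^sup>2 \<le> (real a)\<^sup>2" using A(2) by (intro power_mono) auto
    ultimately show thesis by simp
  next
    case True
    \<comment> \<open>Since \<open>G Mod C\<close> is abelian, conjugating \<open>x\<close> changes
      it only by a factor in \<open>C\<close>, which acts trivially on \<open>N\<close>. So the
      fixed points of \<open>x\<close> in \<open>N\<close> form a normal subgroup of
      \<open>G\<close>, and minimality applies.\<close>
    have cent_triv: "centralizer_in G N x = {\<one>}" if x: "x \<in> carrier G - C" for x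
    proof -
      have "centralizer_in G N x \<lhd> G"
      proof (rule normal_invI)
        show "subgroup (centralizer_in G N x) G" using x S by (intro subgroup_centralizer_in) auto
        fix g n assume g: "g \<in> carrier G" and n: "n \<in> centralizer_in G N x"
        have nN: "n \<in> N" and xn: "x \<otimes> n = n \<otimes> x" using n by (auto simp: centralizer_in_def)
        define c where "c = inv g \<otimes> x \<otimes> inv (inv g) \<otimes> inv x"
        have cC: "c \<in> C" unfolding c_def using quotient_commute[OF CG True, of "inv g" x] g x by blast
        have cc: "c \<in> carrier G" "x \<in> carrier G" "n \<in> carrier G" using cC C_def x nN by auto
        have gx: "inv g \<otimes> x \<otimes> g = c \<otimes> x" using g cc by (simp add: c_def word_simps)
        have cn: "n \<otimes> c = c \<otimes> n" using cC nN by (auto simp: C_def)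
        have "x \<otimes> (g \<otimes> n \<otimes> inv g) = g \<otimes> ((inv g \<otimes> x \<otimes> g) \<otimes> n) \<otimes> inv g"
          using g cc by (simp add: word_simps)
        also have "(inv g \<otimes> x \<otimes> g) \<otimes> n = c \<otimes> (x \<otimes> n)" unfolding gx using cc by (simp add: m_assoc)
        also have "\<dots> = c \<otimes> n \<otimes> x" unfolding xn using cc by (simp add: m_assoc)
        also have "\<dots> = n \<otimes> (inv g \<otimes> x \<otimes> g)" unfolding gx cn[symmetric] using cc by (simp add: m_assoc)
        also have "g \<otimes> (n \<otimes> (inv g \<otimes> x \<otimes> g)) \<otimes> inv g = g \<otimes> n \<otimes> inv g \<otimes> x"
          using g cc by (simp add: word_simps)
        finally show "g \<otimes> n \<otimes> inv g \<in> centralizer_in G N x"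
          using normal_invE(2)[OF N(1) g nN] by (simp add: centralizer_in_def)
      qed
      moreover obtain n where "n \<in> N" "n \<otimes> x \<noteq> x \<otimes> n" using x by (auto simp: C_def)
      then have "n \<in> N - centralizer_in G N x" by (auto simp: centralizer_in_def)
      then have "centralizer_in G N x \<noteq> N" by blast
      moreover have "centralizer_in G N x \<subseteq> N" by (auto simp: centralizer_in_def)
      ultimately show ?thesis using min by blast
    qed
    let ?n = "card N"
    have n0: "0 < ?n" using card_subgroup_pos[OF S] .
    \<comment> \<open>\<open>?D\<close> meets \<open>N\<close> trivially, so
      \<open>card ?D * card N\<close> elements fit into \<open>C\<close>.\<close>
    have CN: "?n * card (centralizer_in G C x) \<le> card C" if x: "x \<in> carrier G - C" for x
    proof -
      let ?D = "centralizer_in G C x"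
      have D: "subgroup ?D G" using x C by (intro subgroup_centralizer_in) auto
      have "?D \<inter> N = centralizer_in G N x" using NC by (auto simp: centralizer_in_def)
      then have "card (?D <#> N) = card ?D * ?n" using card_set_mult[OF D S] cent_triv[OF x] by simp
      moreover have "?D <#> N \<subseteq> C"
        using NC subgroup.m_closed[OF C] by (auto simp: set_mult_def centralizer_in_def)
      then have "card (?D <#> N) \<le> card C" by (intro card_mono finite_subgroup C)
      ultimately show ?thesis by (simp add: mult.commute)
    qed
    have "commuting_probability G * (real a)\<^sup>2 \<le> commuting_probability (G\<lparr>carrier := C\<rparr>)
        + (commuting_probability (G Mod C) * (real a)\<^sup>2 - 1) / real ?n"
      unfolding a_def using CN n0 by (intro commuting_probability_quotient_bound CG) auto
    also have "\<dots> \<le> 1 + (1 * (real a)\<^sup>2 - 1) / real ?n"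
      using A.commuting_probability_bounds(2) CC.commuting_probability_bounds(2)
      by (intro add_mono divide_right_mono diff_mono mult_right_mono) auto
    finally have le: "commuting_probability G * (real a)\<^sup>2 \<le> 1 + ((real a)\<^sup>2 - 1) / real ?n" by simp
    \<comment> \<open>Every nontrivial element of \<open>N\<close> has centralizer exactly
      \<open>C\<close>, hence a class of size \<open>a\<close>.\<close>
    have "a dvd ?n - 1"
    proof (rule dvd_card_normal_minus_1[OF N(1)])
      fix x assume x: "x \<in> N - {\<one>}"
      have "centralizer_in G (carrier G) x = C"
      proof
        show "C \<subseteq> centralizer_in G (carrier G) x" using x by (auto simp: C_def centralizer_in_def)
        show "centralizer_in G (carrier G) x \<subseteq> C"
        proof (rule ccontr)
          assume "\<not> centralizer_in G (carrier G) x \<subseteq> C"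
          then obtain g where "g \<in> carrier G - C" "x \<otimes> g = g \<otimes> x" by (auto simp: centralizer_in_def)
          moreover from this have "x \<in> centralizer_in G N g" using x by (auto simp: centralizer_in_def)
          ultimately show False using cent_triv[of g] x by auto
        qed
      qed
      then show "a * card (centralizer_in G (carrier G) x) = order G" using oa by simp
    qed
    then obtain j where j: "?n - 1 = a * j" by (auto elim: dvdE)
    have oddn: "odd ?n" using odd_card_subgroup[OF S] .
    obtain x where x: "x \<in> N" "x \<noteq> \<one>" using N(2) subgroup.one_closed[OF S] by blast
    have gs: "subgroup (generate G {y}) G" "generate G {y} \<subseteq> N" "y \<in> generate G {y}" if "y \<in> N" for y
      using that generate_subgroup_incl[OF _ S, of "{y}"]
      by (auto intro: generate_is_subgroup generate.incl)
    have "{\<one>} \<subset> N" using x subgroup.one_closed[OF S] by auto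
    then have n3: "3 \<le> ?n" using card_proper_subgroup[OF triv_subgroup S] by simp
    have np: "\<not> prime ?n"
    proof
      assume "prime ?n"
      moreover have "card (generate G {x}) dvd ?n" using gs[OF x(1)] by (intro card_subgroup_dvd S)
      moreover have "card (generate G {x}) \<noteq> 1"
        using gs[OF x(1)] x subgroup.one_closed by (metis card_1_singletonE singletonD)
      ultimately have "card (generate G {x}) = ?n" by (metis prime_nat_iff)
      then have "generate G {x} = N" using gs[OF x(1)] finite_subgroup[OF S] by (intro card_subset_eq)
      with nc x show False by blast
    qed
    \<comment> \<open>Otherwise \<open>N\<close> is central and all its cyclic subgroups are normal
      in \<open>G\<close>, so minimality makes \<open>N\<close> cyclic.\<close>
    have "a \<noteq> 1"
    proof
      assume "a = 1"
      then have CG': "C = carrier G" using oa subgroup.subset[OF C] fin by (intro card_subset_eq) (auto simp: order_def)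
      have "generate G {x} \<lhd> G"
      proof (rule normal_invI)
        fix g h assume g: "g \<in> carrier G" and h: "h \<in> generate G {x}"
        have hN: "h \<in> N" using gs(2)[OF x(1)] h by blast
        have "g \<in> C" using g CG' by simp
        then have "g \<otimes> h = h \<otimes> g" using hN by (simp add: C_def)
        then have "g \<otimes> h \<otimes> inv g = h" using g hN by (simp add: inv_solve_right')
        then show "g \<otimes> h \<otimes> inv g \<in> generate G {x}" using h by simp
      qed (use gs[OF x(1)] in simp)
      then have "generate G {x} = {\<one>} \<or> generate G {x} = N" using gs[OF x(1)] by (intro min)
      with nc[OF x(1)] gs(3)[OF x(1)] x(2) show False by auto
    qed
    have "a \<noteq> 0" using odda by (metis even_zero)
    then have a3: "3 \<le> a" using \<open>a \<noteq> 1\<close> odda by presburger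
    have "j \<noteq> 0" using j n3 by (intro notI) simp
    have "even (?n - 1)" using oddn by simp
    then have "even (a * j)" unfolding j .
    then have "even j" using odda by simp
    then have "2 \<le> j" using \<open>j \<noteq> 0\<close> by presburger
    then have "a * 2 \<le> a * j" by simp
    then have na: "2 * a + 1 \<le> ?n" using j n3 by linarith
    have dlt: "35 / 243 * (real a)\<^sup>2 < 1 + ((real a)\<^sup>2 - 1) / real ?n"
      using le d a3 by (meson less_le_trans mult_strict_right_mono of_nat_0_less_iff order.strict_trans2 zero_less_numeral zero_less_power)
    have "a = 3"
    \<comment> \<open>For \<open>a \<ge> 5\<close> the order of \<open>N\<close> is at least 11.
      Then \<open>dlt\<close> would require (35/243 - 1/11) a^2 < 10/11, which already fails at
      5.\<close>
    proof (rule ccontr)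
      assume "a \<noteq> 3"
      then have a5: "5 \<le> a" using a3 odda by presburger
      then have "11 \<le> real ?n" using na by simp
      then have "((real a)\<^sup>2 - 1) / real ?n \<le> ((real a)\<^sup>2 - 1) / 11"
        using a5 by (intro divide_left_mono) auto
      moreover have "5\<^sup>2 \<le> (real a)\<^sup>2" using a5 by (intro power_mono) auto
      ultimately show False using dlt by (simp add: diff_divide_distrib)
    qed
    have "?n = 25"
    proof -
      have "35 / 27 < 1 + 8 / real ?n" using dlt \<open>a = 3\<close> by simp
      then have "real ?n < 27" using n0 by (simp add: field_simps)
      then have "?n < 27" by simp
      \<comment> \<open>An order below 27 and congruent to 1 modulo 6 is 1, 7, 13, 19 or 25; a prime
        order would make \<open>N\<close> cyclic.\<close>
      moreover have "\<exists>i. ?n = 6 * i + 1"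
      proof -
        obtain i where "j = 2 * i" using \<open>even j\<close> by (auto elim: evenE)
        then have "?n = 6 * i + 1" using j \<open>a = 3\<close> n3 by simp
        then show ?thesis by blast
      qed
      then obtain i where i: "?n = 6 * i + 1" by blast
      ultimately have "i \<in> {0, 1, 2, 3, 4}" by auto
      moreover have "prime (7::nat)" "prime (13::nat)" "prime (19::nat)" by simp_all
      ultimately show ?thesis using i np n3 by auto
    qed
    then show thesis using that[OF CG NC _ _ cent_triv] oa \<open>a = 3\<close> by simp
  qed
qed

end

section \<open>Isoclinism and chief series\<close>

context group
begin

text \<open>Commutators depend only on cosets of the center, so in the isoclinism condition it is
  enough to treat one representative of each coset.\<close>

lemma commutator_mult_central:
  assumes "z \<in> group_center G" "w \<in> group_center G" "a \<in> carrier G" "b \<in> carrier G"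
  shows "commutator G (z \<otimes> a) (w \<otimes> b) = commutator G a b"
proof -
  have zw: "z \<in> carrier G" "w \<in> carrier G" using assms by (auto simp: group_center_def)
  have z: "z \<otimes> u = u \<otimes> z" and w: "w \<otimes> u = u \<otimes> w" if "u \<in> carrier G" for u
    using that assms unfolding group_center_def by blast+
  have "commutator G (z \<otimes> a) (w \<otimes> b) = z \<otimes> (a \<otimes> (w \<otimes> b) \<otimes> inv a) \<otimes> inv z \<otimes> inv (w \<otimes> b)"
    using assms zw by (simp add: commutator_def word_simps)
  also have "\<dots> = a \<otimes> (w \<otimes> b) \<otimes> inv a \<otimes> inv (w \<otimes> b)"
    using z[of "a \<otimes> (w \<otimes> b) \<otimes> inv a"] assms zw by (simp add: inv_solve_right' del: inv_mult_group)
  also have "\<dots> = a \<otimes> w \<otimes> (b \<otimes> inv a \<otimes> inv b) \<otimes> inv w" using assms zw by (simp add: word_simps)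
  also have "a \<otimes> w = w \<otimes> a" using w assms by simp
  also have "w \<otimes> a \<otimes> (b \<otimes> inv a \<otimes> inv b) \<otimes> inv w = w \<otimes> (a \<otimes> b \<otimes> inv a \<otimes> inv b) \<otimes> inv w"
    using assms zw by (simp add: word_simps)
  also have "\<dots> = commutator G a b"
    using w[of "a \<otimes> b \<otimes> inv a \<otimes> inv b"] assms zw by (simp add: inv_solve_right' commutator_def)
  finally show ?thesis .
qed

end

text \<open>If \<open>\<theta> x\<close> is central, every commutator of \<open>x\<close> lies in
  the kernel and in the derived subgroup, hence is trivial. So \<open>\<theta>\<close> detects the
  center and induces an isomorphism of the central quotients, while its restriction to the derived
  subgroups is injective by \<open>ker\<close>.\<close>

theorem isoclinic_of_surj_hom:
  assumes "group G" "group H" and hom: "\<theta> \<in> hom G H" and surj: "\<theta> ` carrier G = carrier H"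
    and ker: "\<And>x. x \<in> derived G (carrier G) \<Longrightarrow> \<theta> x = \<one>\<^bsub>H\<^esub> \<Longrightarrow> x = \<one>\<^bsub>G\<^esub>"
  shows "isoclinic G H"
proof -
  interpret G: group G by fact
  interpret H: group H by fact
  interpret group_hom G H \<theta> using hom by unfold_locales
  let ?Z = "group_center G" and ?Y = "group_center H"
  let ?D = "derived G (carrier G)"
  interpret Z: normal ?Z G by (rule G.group_center_normal)
  interpret Y: normal ?Y H by (rule H.group_center_normal)
  have comm: "\<theta> (commutator G x y) = commutator H (\<theta> x) (\<theta> y)"
    if "x \<in> carrier G" "y \<in> carrier G" for x y
    using that by (simp add: commutator_def)
  have Z_iff: "x \<in> ?Z \<longleftrightarrow> \<theta> x \<in> ?Y" if x: "x \<in> carrier G" for x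
  proof
    assume "x \<in> ?Z"
    then have "\<theta> x \<otimes>\<^bsub>H\<^esub> \<theta> y = \<theta> y \<otimes>\<^bsub>H\<^esub> \<theta> x" if "y \<in> carrier G" for y
      using that x unfolding group_center_def by (metis (mono_tags, lifting) hom_mult mem_Collect_eq)
    then show "\<theta> x \<in> ?Y" using x unfolding group_center_def by (auto simp flip: surj)
  next
    assume Y: "\<theta> x \<in> ?Y"
    have "x \<otimes>\<^bsub>G\<^esub> y = y \<otimes>\<^bsub>G\<^esub> x" if y: "y \<in> carrier G" for y
    proof -
      have "\<theta> x \<otimes>\<^bsub>H\<^esub> \<theta> y = \<theta> y \<otimes>\<^bsub>H\<^esub> \<theta> x" using Y y unfolding group_center_def by simp
      then have "\<theta> (x \<otimes>\<^bsub>G\<^esub> y \<otimes>\<^bsub>G\<^esub> inv\<^bsub>G\<^esub> x \<otimes>\<^bsub>G\<^esub> inv\<^bsub>G\<^esub> y) = \<one>\<^bsub>H\<^esub>"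
        using H.mult_eq_commute_iff[of "\<theta> x" "\<theta> y"] x y by simp
      then have "x \<otimes>\<^bsub>G\<^esub> y \<otimes>\<^bsub>G\<^esub> inv\<^bsub>G\<^esub> x \<otimes>\<^bsub>G\<^esub> inv\<^bsub>G\<^esub> y = \<one>\<^bsub>G\<^esub>"
        using x y by (intro ker G.derived_memI)
      then show ?thesis using x y by (simp add: G.mult_eq_commute_iff)
    qed
    then show "x \<in> ?Z" using x unfolding group_center_def by blast
  qed
  have imZ: "\<theta> ` ?Z = ?Y"
  proof
    show "\<theta> ` ?Z \<subseteq> ?Y" using Z_iff Z.subset by blast
    show "?Y \<subseteq> \<theta> ` ?Z"
    proof
      fix y assume y: "y \<in> ?Y"
      then obtain x where "x \<in> carrier G" "y = \<theta> x" using surj Y.subset by blast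
      with y Z_iff show "y \<in> \<theta> ` ?Z" by blast
    qed
  qed
  have coset: "\<theta> ` (?Z #>\<^bsub>G\<^esub> g) = ?Y #>\<^bsub>H\<^esub> \<theta> g" if "g \<in> carrier G" for g
    unfolding r_coset_def imZ[symmetric] image_UN using that by simp
  have iso1: "image \<theta> \<in> iso (G Mod ?Z) (H Mod ?Y)"
  proof (rule isoI)
    show "image \<theta> \<in> hom (G Mod ?Z) (H Mod ?Y)"
    proof (rule homI)
      fix A assume "A \<in> carrier (G Mod ?Z)"
      then show "\<theta> ` A \<in> carrier (H Mod ?Y)" by (auto simp: carrier_FactGroup coset)
    next
      fix A B assume "A \<in> carrier (G Mod ?Z)" "B \<in> carrier (G Mod ?Z)"
      then obtain a b where ab: "a \<in> carrier G" "b \<in> carrier G" "A = ?Z #>\<^bsub>G\<^esub> a" "B = ?Z #>\<^bsub>G\<^esub> b"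
        by (auto simp: carrier_FactGroup)
      then show "\<theta> ` (A \<otimes>\<^bsub>G Mod ?Z\<^esub> B) = \<theta> ` A \<otimes>\<^bsub>H Mod ?Y\<^esub> \<theta> ` B"
        by (simp add: Z.rcos_sum coset Y.rcos_sum)
    qed
    have "inj_on (image \<theta>) (carrier (G Mod ?Z))"
    proof (rule inj_onI)
      fix A B assume "A \<in> carrier (G Mod ?Z)" "B \<in> carrier (G Mod ?Z)" and eq: "\<theta> ` A = \<theta> ` B"
      then obtain a b where ab: "a \<in> carrier G" "b \<in> carrier G" "A = ?Z #>\<^bsub>G\<^esub> a" "B = ?Z #>\<^bsub>G\<^esub> b"
        by (auto simp: carrier_FactGroup)
      then have "?Y #>\<^bsub>H\<^esub> \<theta> b = ?Y #>\<^bsub>H\<^esub> \<theta> a" using eq coset by simp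
      then have "\<theta> a \<in> ?Y #>\<^bsub>H\<^esub> \<theta> b" using H.rcos_self[OF _ Y.subgroup_axioms] ab by simp
      then have "\<theta> a \<otimes>\<^bsub>H\<^esub> inv\<^bsub>H\<^esub> \<theta> b \<in> ?Y" using Y.rcos_module_imp[OF H.group_axioms] ab by simp
      then have "a \<otimes>\<^bsub>G\<^esub> inv\<^bsub>G\<^esub> b \<in> ?Z" using Z_iff ab by simp
      then have "a \<in> ?Z #>\<^bsub>G\<^esub> b" using Z.rcos_module_rev[OF G.group_axioms] ab by simp
      then show "A = B" using G.repr_independence[OF _ _ Z.subgroup_axioms] ab by simp
    qed
    moreover have "image \<theta> ` carrier (G Mod ?Z) = carrier (H Mod ?Y)"
      unfolding carrier_FactGroup surj[symmetric] image_image by (intro image_cong) (auto simp: coset)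
    ultimately show "bij_betw (image \<theta>) (carrier (G Mod ?Z)) (carrier (H Mod ?Y))"
      by (simp add: bij_betw_def)
  qed
  have D: "subgroup ?D G" by (intro G.derived_is_subgroup) simp
  have iso2: "\<theta> \<in> iso (derived_group G) (derived_group H)"
  proof (rule isoI)
    have im: "\<theta> ` ?D = derived H (carrier H)" using derived_img[of "carrier G"] surj by simp
    then show "\<theta> \<in> hom (derived_group G) (derived_group H)"
      using subgroup.mem_carrier[OF D] by (auto simp: hom_def derived_group_def)
    have "inj_on \<theta> ?D"
    proof (rule inj_onI)
      fix x y assume xy: "x \<in> ?D" "y \<in> ?D" "\<theta> x = \<theta> y"
      then have c: "x \<in> carrier G" "y \<in> carrier G" using subgroup.mem_carrier[OF D] by auto
      have "x \<otimes>\<^bsub>G\<^esub> inv\<^bsub>G\<^esub> y \<in> ?D" using xy D by (intro subgroup.m_closed subgroup.m_inv_closed)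
      moreover have "\<theta> (x \<otimes>\<^bsub>G\<^esub> inv\<^bsub>G\<^esub> y) = \<one>\<^bsub>H\<^esub>" using xy c by simp
      ultimately have "x \<otimes>\<^bsub>G\<^esub> inv\<^bsub>G\<^esub> y = \<one>\<^bsub>G\<^esub>" by (rule ker)
      then show "x = y" using c by (simp add: G.inv_solve_right')
    qed
    then show "bij_betw \<theta> (carrier (derived_group G)) (carrier (derived_group H))"
      using im by (simp add: bij_betw_def derived_group_def)
  qed
  have rep: "\<exists>z \<in> ?Y. h = z \<otimes>\<^bsub>H\<^esub> \<theta> g"
    if "g \<in> carrier G" "h \<in> carrier H" "\<theta> ` (?Z #>\<^bsub>G\<^esub> g) = ?Y #>\<^bsub>H\<^esub> h" for g h
  proof -
    have "h \<in> ?Y #>\<^bsub>H\<^esub> \<theta> g" using H.rcos_self[OF that(2) Y.subgroup_axioms] that coset by simp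
    then show ?thesis by (auto simp: r_coset_def)
  qed
  show ?thesis unfolding isoclinic_def
  proof (intro bexI[OF _ iso1] bexI[OF _ iso2] ballI impI)
    fix g1 g2 h1 h2
    assume c: "g1 \<in> carrier G" "g2 \<in> carrier G" "h1 \<in> carrier H" "h2 \<in> carrier H"
      and "\<theta> ` (?Z #>\<^bsub>G\<^esub> g1) = ?Y #>\<^bsub>H\<^esub> h1 \<and> \<theta> ` (?Z #>\<^bsub>G\<^esub> g2) = ?Y #>\<^bsub>H\<^esub> h2"
    then obtain z w where "z \<in> ?Y" "h1 = z \<otimes>\<^bsub>H\<^esub> \<theta> g1" "w \<in> ?Y" "h2 = w \<otimes>\<^bsub>H\<^esub> \<theta> g2"
      using rep by metis
    then show "\<theta> (commutator G g1 g2) = commutator H h1 h2"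
      using c by (simp add: comm H.commutator_mult_central)
  qed
qed

section \<open>From failure of supersolvability to an abelian normal subgroup of index 3\<close>

context odd_group
begin

text \<open>The cosets of \<open>K\<close> in the preimage are the members of \<open>L\<close>, so
  the two quotient records are literally equal and a generator carries over.\<close>

lemma quotient_cyclic:
  assumes K: "K \<lhd> G" and L: "L \<lhd> (G Mod K)" and x: "x \<in> L" "generate (G Mod K) {x} = L"
  shows "cyclic_group (G\<lparr>carrier := {x \<in> carrier G. K #> x \<in> L}\<rparr> Mod K)"
proof -
  let ?P = "{x \<in> carrier G. K #> x \<in> L}"
  interpret Q: group "G Mod K" using K by (rule normal.factorgroup_is_group)
  have "(G\<lparr>carrier := ?P\<rparr> Mod K) = (G Mod K)\<lparr>carrier := (#>) K ` ?P\<rparr>"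
    by (auto simp: FactGroup_def RCOSETS_def fun_eq_iff)
  also have "(#>) K ` ?P = L" using quotient_normal_preimage(3)[OF K L] by (rule sym)
  finally have "(G\<lparr>carrier := ?P\<rparr> Mod K) = (G Mod K)\<lparr>carrier := L\<rparr>" .
  moreover have "generate ((G Mod K)\<lparr>carrier := L\<rparr>) {x} = L"
    using Q.generate_consistent[OF _ normal_imp_subgroup[OF L], of "{x}"] x by simp
  then have "cyclic_group ((G Mod K)\<lparr>carrier := L\<rparr>)"
    unfolding cyclic_group_def subgroup_generated_def using x(1)
    by (intro bexI[of _ x]) auto
  ultimately show ?thesis by simp
qed

text \<open>Take \<open>K\<close> maximal among the normal subgroups reached by a normal series with
  cyclic factors. A minimal normal subgroup of \<open>G Mod K\<close> cannot be cyclic, since its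
  preimage would prolong the series.\<close>

theorem not_supersolvable_imp_abelian_index_3:
  assumes d: "35 / 243 < commuting_probability G" and nss: "\<not> supersolvable G"
  obtains C where "C \<lhd> G" "order G = 3 * card C"
    "\<And>x y. x \<in> C \<Longrightarrow> y \<in> C \<Longrightarrow> x \<otimes> y = y \<otimes> x"
    "\<And>x. x \<in> carrier G - C \<Longrightarrow> 25 * card (centralizer_in G C x) \<le> card C"
proof -
  \<comment> \<open>The condition in \<open>supersolvable\<close>, with the series ending at
    \<open>K\<close> instead of the whole group.\<close>
  define series where "series K n N \<longleftrightarrow> N 0 = {\<one>} \<and> N n = K \<and> (\<forall>i \<le> n. N i \<lhd> G) \<and>
        (\<forall>i < n. N i \<subseteq> N (Suc i) \<and> cyclic_group (G\<lparr>carrier := N (Suc i)\<rparr> Mod N i))"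
    for K and n :: nat and N
  have "series {\<one>} 0 (\<lambda>_. {\<one>})" by (simp add: series_def one_is_normal)
  then obtain K where K: "K \<lhd> G" "\<exists>n N. series K n N"
    and max: "\<And>M. M \<lhd> G \<Longrightarrow> \<exists>n N. series M n N \<Longrightarrow> K \<subseteq> M \<Longrightarrow> M = K"
    using ex_maximal_normal[of "\<lambda>K. \<exists>n N. series K n N" "{\<one>}"] one_is_normal by blast
  have "supersolvable G \<longleftrightarrow> (\<exists>n N. series (carrier G) n N)"
    unfolding supersolvable_def series_def ..
  with K(2) nss have KG: "K \<noteq> carrier G" by blast
  have SK: "subgroup K G" using K(1) by (rule normal_imp_subgroup)
  interpret Q: odd_group "G Mod K" using K(1) by (rule odd_group_quotient)
  have KK: "K #> x = K \<longleftrightarrow> x \<in> K" if "x \<in> carrier G" for x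
    using that SK coset_join1 coset_join2 by blast
  have "carrier (G Mod K) \<noteq> {K}"
  proof
    assume *: "carrier (G Mod K) = {K}"
    have "x \<in> K" if "x \<in> carrier G" for x
      using that KK * by (auto simp: carrier_FactGroup)
    with KG subgroup.subset[OF SK] show False by blast
  qed
  then obtain N where N: "N \<lhd> (G Mod K)" "N \<noteq> {K}"
    and min: "\<And>M. M \<lhd> (G Mod K) \<Longrightarrow> M \<noteq> {K} \<Longrightarrow> M \<subseteq> N \<Longrightarrow> M = N"
    using Q.ex_minimal_normal[of "\<lambda>N. N \<noteq> {K}", OF _ Q.normal_self] by metis
  let ?M = "{x \<in> carrier G. K #> x \<in> N}"
  note M = quotient_normal_preimage[OF K(1) N(1)]
  have nc: "generate (G Mod K) {x} \<noteq> N" if x: "x \<in> N" for x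
  proof
    assume *: "generate (G Mod K) {x} = N"
    obtain n S where S: "series K n S" using K(2) by blast
    define S' where "S' = S(Suc n := ?M)"
    have "series ?M (Suc n) S'"
      using S M(1,2) quotient_cyclic[OF K(1) N(1) x *]
      by (auto simp: series_def S'_def le_Suc_eq less_Suc_eq)
    then have "?M = K" using max M(1,2) by blast
    then have "(#>) K ` ?M = (#>) K ` K" by (rule arg_cong)
    also have "\<dots> = {K}"
    proof -
      have "K #> k = K" if "k \<in> K" for k using that KK subgroup.mem_carrier[OF SK] by blast
      then show ?thesis using subgroup.one_closed[OF SK] by blast
    qed
    finally have "N = {K}" using M(3) by (rule trans[rotated])
    then show False using N(2) by simp
  qed
  have dQ: "35 / 243 < commuting_probability (G Mod K)"
    using d commuting_probability_mono(2)[OF K(1)] by simp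
  have N1: "N \<noteq> {\<one>\<^bsub>G Mod K\<^esub>}" using N(2) by simp
  have min1: "M = {\<one>\<^bsub>G Mod K\<^esub>} \<or> M = N" if "M \<lhd> (G Mod K)" "M \<subseteq> N" for M
    using min that by auto
  obtain B where B: "B \<lhd> (G Mod K)" "N \<subseteq> B" "order (G Mod K) = 3 * card B" "card N = 25"
    "\<And>x. x \<in> carrier (G Mod K) - B \<Longrightarrow> centralizer_in (G Mod K) N x = {\<one>\<^bsub>G Mod K\<^esub>}"
    using Q.minimal_normal_noncyclic[OF dQ N(1) N1 min1 nc] by blast
  define C where "C = {x \<in> carrier G. K #> x \<in> B}"
  note C = quotient_normal_preimage[OF K(1) B(1), folded C_def]
  have SC: "subgroup C G" using C(1) by (rule normal_imp_subgroup)
  have SM: "subgroup ?M G" using M(1) by (rule normal_imp_subgroup)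
  have MC: "?M \<subseteq> C" using B(2) by (auto simp: C_def)
  have cK: "0 < card K" using card_subgroup_pos[OF SK] .
  have "order G = order (G Mod K) * card K" using lagrange[OF SK] by (simp add: order_def FactGroup_def)
  then have oC: "order G = 3 * card C" using B(3) C(4) by simp
  have cM: "card ?M = 25 * card K" using M(4) B(4) by simp
  have C25: "25 * card (centralizer_in G C x) \<le> card C" if x: "x \<in> carrier G - C" for x
  proof -
    let ?D = "centralizer_in G C x"
    have D: "subgroup ?D G" using x SC by (intro subgroup_centralizer_in) auto
    \<comment> \<open>Elements commuting in \<open>G\<close> commute modulo \<open>K\<close>, where
      only the trivial coset in \<open>N\<close> is fixed by an outside element. As
      \<open>card ?M\<close> is \<open>25 * card K\<close>, the factor 25 survives the passage to
      \<open>G\<close>.\<close>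
    have "?D \<inter> ?M \<subseteq> K"
    proof
      fix n assume n: "n \<in> ?D \<inter> ?M"
      have "K #> n \<in> centralizer_in (G Mod K) N (K #> x)"
        using n x normal.rcos_sum[OF K(1)] by (simp add: centralizer_in_def)
      also have "\<dots> = {K}" using B(5)[of "K #> x"] x by (simp add: carrier_FactGroup C_def)
      finally show "n \<in> K" using KK n by simp
    qed
    then have "card (?D \<inter> ?M) \<le> card K" by (intro card_mono finite_subgroup SK)
    moreover have "?D <#> ?M \<subseteq> C"
      using MC subgroup.m_closed[OF SC] by (auto simp: set_mult_def centralizer_in_def)
    then have "card (?D <#> ?M) \<le> card C" by (intro card_mono finite_subgroup SC)
    ultimately have "card (?D <#> ?M) * card (?D \<inter> ?M) \<le> card C * card K" by (intro mult_le_mono)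
    then have "25 * card ?D * card K \<le> card C * card K"
      unfolding card_set_mult[OF D SM] cM by (simp add: ac_simps)
    then show ?thesis using cK by simp
  qed
  have cR: "card (rcosets C) = 3"
    using lagrange[OF SC] oC card_subgroup_pos[OF SC] by (metis mult_right_cancel neq0_conv)
  interpret A: finite_group "G Mod C" using C(1) by (rule finite_group_quotient)
  interpret CC: odd_group "G\<lparr>carrier := C\<rparr>" using SC by (rule odd_group_subgroup)
  have "comm_group (G\<lparr>carrier := C\<rparr>)"
  proof (rule ccontr)
    assume "\<not> comm_group (G\<lparr>carrier := C\<rparr>)"
    then have "commuting_probability (G\<lparr>carrier := C\<rparr>) \<le> 11 / 27" by (rule CC.nonabelian_bounds)
    moreover have "commuting_probability G * (real 3)\<^sup>2 \<le> commuting_probability (G\<lparr>carrier := C\<rparr>)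
        + (commuting_probability (G Mod C) * (real 3)\<^sup>2 - 1) / real 25"
      unfolding cR[symmetric] using C25 by (intro commuting_probability_quotient_bound C(1)) auto
    moreover note A.commuting_probability_bounds(2)
    \<comment> \<open>A nonabelian \<open>C\<close> would give 9 d <= 11/27 + 8/25, far below
      35/27.\<close>
    ultimately show False using d by (simp add: diff_divide_distrib)
  qed
  then have "x \<otimes> y = y \<otimes> x" if "x \<in> C" "y \<in> C" for x y
    using comm_monoid.m_comm[of "G\<lparr>carrier := C\<rparr>" x y] that by (simp add: comm_group_def)
  then show thesis using that C(1) oC C25 by blast
qed

end

section \<open>Groups with an abelian normal subgroup of index 3\<close>

text \<open>The first isomorphism theorem as a count; the codomain is cut down to the image to make
  the map surjective.\<close>

lemma (in group_hom) card_image_kernel: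
  "card (h ` carrier G) * card (kernel G H h) = order G"
proof -
  let ?I = "H\<lparr>carrier := h ` carrier G\<rparr>"
  have "group ?I" using img_is_subgroup by (rule H.subgroup_imp_group)
  then interpret I: group_hom G ?I h
    by (intro group_hom.intro group_hom_axioms.intro G.group_axioms) (auto simp: hom_def)
  have "kernel G ?I h = kernel G H h" by (simp add: kernel_def)
  then have "G Mod kernel G H h \<cong> ?I" using I.FactGroup_iso by simp
  then have "card (rcosets\<^bsub>G\<^esub> kernel G H h) = card (h ` carrier G)"
    using iso_same_card by (fastforce simp: FactGroup_def)
  then show ?thesis using G.lagrange[OF subgroup_kernel] by simp
qed

context group
begin

text \<open>This is the preimage of the centralizer of the coset of \<open>x\<close> modulo
  \<open>D\<close>. Closure rests on [x, g^-1] = g^-1 [x, g]^-1 g and [x, g h] = [x, g] g [x, h]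
  g^-1.\<close>

lemma subgroup_commuting_mod:
  assumes D: "D \<lhd> G" and x: "x \<in> carrier G"
  shows "subgroup {g \<in> carrier G. x \<otimes> g \<otimes> inv x \<otimes> inv g \<in> D} G"
proof (rule subgroupI)
  interpret D: normal D G by fact
  have "\<one> \<in> {g \<in> carrier G. x \<otimes> g \<otimes> inv x \<otimes> inv g \<in> D}"
    using x D.subgroup_axioms subgroup.one_closed by fastforce
  then show "{g \<in> carrier G. x \<otimes> g \<otimes> inv x \<otimes> inv g \<in> D} \<noteq> {}" by blast
  fix g assume g: "g \<in> {g \<in> carrier G. x \<otimes> g \<otimes> inv x \<otimes> inv g \<in> D}"
  then have "inv g \<otimes> inv (x \<otimes> g \<otimes> inv x \<otimes> inv g) \<otimes> g \<in> D"
    by (auto intro: D.inv_op_closed1 subgroup.m_inv_closed[OF D.subgroup_axioms])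
  then show "inv g \<in> {g \<in> carrier G. x \<otimes> g \<otimes> inv x \<otimes> inv g \<in> D}"
    using g x by (simp add: word_simps)
  fix h assume h: "h \<in> {g \<in> carrier G. x \<otimes> g \<otimes> inv x \<otimes> inv g \<in> D}"
  have "(x \<otimes> g \<otimes> inv x \<otimes> inv g) \<otimes> (g \<otimes> (x \<otimes> h \<otimes> inv x \<otimes> inv h) \<otimes> inv g) \<in> D"
    using g h by (auto intro: subgroup.m_closed[OF D.subgroup_axioms, OF _ D.inv_op_closed2])
  then show "g \<otimes> h \<in> {g \<in> carrier G. x \<otimes> g \<otimes> inv x \<otimes> inv g \<in> D}"
    using g h x by (simp add: word_simps)
qed auto

end

locale abelian_index_3 = odd_group +
  fixes C :: "'a set" and t :: 'a
  assumes C_normal: "C \<lhd> G"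
    and order_eq: "order G = 3 * card C"
    and C_comm: "\<And>x y. x \<in> C \<Longrightarrow> y \<in> C \<Longrightarrow> x \<otimes> y = y \<otimes> x"
    and t: "t \<in> carrier G" "t \<notin> C"
    and centralizer_t: "centralizer_in G C t = group_center G"
    and card_center: "card C = 25 * card (group_center G)"
begin

abbreviation Z :: "'a set" where "Z \<equiv> group_center G"

definition \<tau> :: "'a \<Rightarrow> 'a" where "\<tau> u = t \<otimes> u \<otimes> inv t"

text \<open>With \<open>C\<close> written additively, this is the image of 1 -
  \<open>\<tau>\<close>. The kernel consists of the fixed points of \<open>\<tau>\<close>, which
  form the center, so the image has order 25.\<close>

definition D :: "'a set" where "D = (\<lambda>c. c \<otimes> inv (\<tau> c)) ` C"

lemma C_subgroup: "subgroup C G" using C_normal by (rule normal_imp_subgroup)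
lemma Z_subgroup: "subgroup Z G" using group_center_normal by (rule normal_imp_subgroup)

lemmas C_closed [simp] = subgroup.mem_carrier[OF C_subgroup] subgroup.m_closed[OF C_subgroup]
  subgroup.m_inv_closed[OF C_subgroup] subgroup.one_closed[OF C_subgroup]

lemma C_lcomm: "x \<in> C \<Longrightarrow> y \<in> C \<Longrightarrow> z \<in> C \<Longrightarrow> x \<otimes> (y \<otimes> z) = y \<otimes> (x \<otimes> z)"
  using C_comm[of x y] by (simp flip: m_assoc)

lemma Z_C: "Z \<subseteq> C" unfolding centralizer_t[symmetric] by (auto simp: centralizer_in_def)

lemma Z_iff: "z \<in> Z \<longleftrightarrow> z \<in> C \<and> \<tau> z = z"
  unfolding centralizer_t[symmetric] using t
  by (auto simp: centralizer_in_def \<tau>_def inv_solve_right')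

lemma Z_commute: "z \<in> Z \<Longrightarrow> x \<in> carrier G \<Longrightarrow> z \<otimes> x = x \<otimes> z"
  by (auto simp: group_center_def)

text \<open>\<open>C\<close> has index 3 and is therefore a maximal subgroup.\<close>

lemma eq_carrierI:
  assumes H: "subgroup H G" and "C \<subseteq> H" "x \<in> H" "x \<notin> C"
  shows "H = carrier G"
proof -
  have "3 * card C \<le> card H" using assms by (intro card_proper_subgroup C_subgroup) auto
  moreover have "0 < card H" using H by (rule card_subgroup_pos)
  ultimately show ?thesis using order_eq by (intro subgroup_eq_carrier H) simp
qed

lemma \<tau>_C [simp]: "c \<in> C \<Longrightarrow> \<tau> c \<in> C"
  using normal_invE(2)[OF C_normal t(1)] by (simp add: \<tau>_def)

lemma \<tau>_mult: "a \<in> carrier G \<Longrightarrow> b \<in> carrier G \<Longrightarrow> \<tau> (a \<otimes> b) = \<tau> a \<otimes> \<tau> b"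
  using t by (simp add: \<tau>_def word_simps)

lemma \<tau>_inv: "a \<in> carrier G \<Longrightarrow> \<tau> (inv a) = inv (\<tau> a)"
  using t by (simp add: \<tau>_def word_simps)

lemma \<tau>_one: "\<tau> \<one> = \<one>"
  using t by (simp add: \<tau>_def)

text \<open>The quotient by \<open>C\<close> has order 3, so the cube lies in \<open>C\<close>; it
  commutes with \<open>t\<close>, and \<open>centralizer_t\<close> makes it central.\<close>

lemma t_cube: "t \<otimes> t \<otimes> t \<in> Z"
proof -
  interpret C: normal C G by (rule C_normal)
  interpret Q: group "G Mod C" by (rule C.factorgroup_is_group)
  have "card (rcosets C) * card C = 3 * card C" using lagrange[OF C_subgroup] order_eq by simp
  then have "order (G Mod C) = 3"
    using card_subgroup_pos[OF C_subgroup] by (simp add: order_def FactGroup_def)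
  moreover have "C #> t \<in> carrier (G Mod C)" using t by (auto simp: carrier_FactGroup)
  ultimately have "(C #> t) [^]\<^bsub>G Mod C\<^esub> (3::nat) = C" using Q.pow_order_eq_1 by force
  then have "C #> (t [^] (3::nat)) = C" using t C.FactGroup_pow by simp
  then have "t [^] (3::nat) \<in> C" by (rule coset_join1) (use t C_subgroup in simp_all)
  then have "t \<otimes> t \<otimes> t \<in> C" using t by (simp add: numeral_3_eq_3)
  moreover have "t \<otimes> (t \<otimes> t \<otimes> t) = t \<otimes> t \<otimes> t \<otimes> t" using t by (simp add: m_assoc)
  ultimately show ?thesis unfolding centralizer_t[symmetric] by (simp add: centralizer_in_def)
qed

lemma \<tau>_cube:
  assumes "c \<in> carrier G"
  shows "\<tau> (\<tau> (\<tau> c)) = c"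
proof -
  have "\<tau> (\<tau> (\<tau> c)) = (t \<otimes> t \<otimes> t) \<otimes> c \<otimes> inv (t \<otimes> t \<otimes> t)"
    using t assms by (simp add: \<tau>_def word_simps)
  also have "\<dots> = c" using Z_commute[OF t_cube assms] t assms by (simp add: inv_solve_right')
  finally show ?thesis .
qed

lemma D_C: "D \<subseteq> C" by (auto simp: D_def)

lemma D_group_hom: "group_hom (G\<lparr>carrier := C\<rparr>) (G\<lparr>carrier := C\<rparr>) (\<lambda>c. c \<otimes> inv (\<tau> c))"
proof -
  have "group (G\<lparr>carrier := C\<rparr>)" using C_subgroup by (rule subgroup_imp_group)
  moreover have "a \<otimes> b \<otimes> inv (\<tau> (a \<otimes> b)) = a \<otimes> inv (\<tau> a) \<otimes> (b \<otimes> inv (\<tau> b))" if "a \<in> C" "b \<in> C" for a b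
    using that C_comm C_lcomm by (simp add: \<tau>_mult word_simps)
  ultimately show ?thesis by (auto simp: group_hom_def group_hom_axioms_def hom_def)
qed

lemma D_subgroup: "subgroup D G"
  using group_hom.img_is_subgroup[OF D_group_hom] unfolding D_def
  by (intro incl_subgroup[OF C_subgroup]) simp

lemma card_D: "card D = 25"
proof -
  have "kernel (G\<lparr>carrier := C\<rparr>) (G\<lparr>carrier := C\<rparr>) (\<lambda>c. c \<otimes> inv (\<tau> c)) = Z"
    by (auto simp: kernel_def Z_iff inv_solve_right')
  then have "card D * card Z = card C"
    using group_hom.card_image_kernel[OF D_group_hom] by (simp add: D_def order_def)
  then show ?thesis using card_center card_subgroup_pos[OF Z_subgroup] by simp
qed

lemma \<tau>_D: "d \<in> D \<Longrightarrow> \<tau> d \<in> D"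
proof -
  assume "d \<in> D"
  then obtain c where "c \<in> C" "d = c \<otimes> inv (\<tau> c)" by (auto simp: D_def)
  then have "\<tau> d = \<tau> c \<otimes> inv (\<tau> (\<tau> c))" by (simp add: \<tau>_mult \<tau>_inv)
  then show "\<tau> d \<in> D" using \<open>c \<in> C\<close> by (auto simp: D_def)
qed

text \<open>Additively, (1 + \<open>\<tau>\<close> + \<open>\<tau>\<close>^2)(1 -
  \<open>\<tau>\<close>) = 1 - \<open>\<tau>\<close>^3 = 0.\<close>

lemma norm_D:
  assumes "d \<in> D"
  shows "d \<otimes> \<tau> d \<otimes> \<tau> (\<tau> d) = \<one>"
proof -
  obtain c where c: "c \<in> C" "d = c \<otimes> inv (\<tau> c)" using assms by (auto simp: D_def)
  then have "d \<otimes> \<tau> d \<otimes> \<tau> (\<tau> d) = c \<otimes> inv (\<tau> c) \<otimes> (\<tau> c \<otimes> inv (\<tau> (\<tau> c))) \<otimes> (\<tau> (\<tau> c) \<otimes> inv c)"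
    by (simp add: \<tau>_mult \<tau>_inv \<tau>_cube)
  also have "\<dots> = \<one>" using c by (simp add: word_simps)
  finally show ?thesis .
qed

text \<open>The normalizer of \<open>D\<close> contains the abelian group \<open>C\<close> and also
  \<open>t\<close>, hence everything by maximality of \<open>C\<close>.\<close>

lemma D_normal: "D \<lhd> G"
proof (rule normal_of_conj_eq[OF D_subgroup])
  note D_sub = subgroup.subset[OF D_subgroup]
  have C: "C \<subseteq> {g \<in> carrier G. conj_set g D = D}"
  proof clarsimp
    fix g assume g: "g \<in> C"
    have "g \<otimes> d \<otimes> inv g = d" if "d \<in> D" for d
      using g that D_C C_comm[of g d] by (auto simp: inv_solve_right' subset_iff)
    then show "conj_set g D = D" by (simp add: conj_set_def)
  qed
  have "conj_set t D \<subseteq> D" using \<tau>_D by (auto simp: conj_set_def \<tau>_def)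
  then have "conj_set t D = D"
    using card_conj[OF t(1) D_sub] finite_subgroup[OF D_subgroup] by (intro card_subset_eq)
  then have "{g \<in> carrier G. conj_set g D = D} = carrier G"
    using t by (intro eq_carrierI[OF subgroup_conj_stabilizer[OF D_sub] C, of t]) auto
  then show "conj_set g D = D" if "g \<in> carrier G" for g using that by blast
qed

text \<open>Let \<open>?H x\<close> collect the elements commuting with \<open>x\<close> modulo
  \<open>D\<close>. For \<open>x\<close> in \<open>C\<close> it contains \<open>C\<close> and, by
  the choice of \<open>D\<close>, also \<open>t\<close>; for \<open>x\<close> outside
  \<open>C\<close> it contains \<open>C\<close> by the first case and \<open>x\<close> itself.
  Either way it is all of \<open>G\<close>.\<close>

lemma derived_D: "derived G (carrier G) \<subseteq> D"
proof (rule derived_subset[OF D_subgroup])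
  let ?H = "\<lambda>x. {g \<in> carrier G. x \<otimes> g \<otimes> inv x \<otimes> inv g \<in> D}"
  note one = subgroup.one_closed[OF D_subgroup]
  have H: "subgroup (?H x) G" if "x \<in> carrier G" for x
    using D_normal that by (rule subgroup_commuting_mod)
  have C: "x \<otimes> g \<otimes> inv x \<otimes> inv g \<in> D" if x: "x \<in> C" and g: "g \<in> carrier G" for x g
  proof -
    have "C \<subseteq> ?H x"
    proof
      fix c assume c: "c \<in> C"
      then have "x \<otimes> c \<otimes> inv x \<otimes> inv c = \<one>" using x C_comm[of x c] by (simp add: inv_solve_right')
      then show "c \<in> ?H x" using c one by simp
    qed
    moreover have "x \<otimes> inv (\<tau> x) \<in> D" using x by (auto simp: D_def)
    then have "t \<in> ?H x" using t x by (simp add: \<tau>_def word_simps)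
    ultimately have "?H x = carrier G" using t x by (intro eq_carrierI[of _ t] H) auto
    with g show ?thesis by blast
  qed
  fix x y assume x: "x \<in> carrier G" and y: "y \<in> carrier G"
  show "x \<otimes> y \<otimes> inv x \<otimes> inv y \<in> D"
  proof (cases "x \<in> C")
    case False
    have "C \<subseteq> ?H x"
    proof
      fix c assume c: "c \<in> C"
      then have "inv (c \<otimes> x \<otimes> inv c \<otimes> inv x) \<in> D" using x by (intro subgroup.m_inv_closed[OF D_subgroup] C)
      then show "c \<in> ?H x" using c x by (simp add: word_simps)
    qed
    moreover have "x \<in> ?H x" using x one by (simp add: word_simps)
    ultimately have "?H x = carrier G" using False x by (intro eq_carrierI[of _ x] H) auto
    then show ?thesis using y by blast
  qed (use C y in simp)
qed

lemma pow_25: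
  assumes "d \<in> D"
  shows "d [^] (25::nat) = \<one>"
proof -
  interpret D: group "G\<lparr>carrier := D\<rparr>" using D_subgroup by (rule subgroup_imp_group)
  have "order (G\<lparr>carrier := D\<rparr>) = 25" by (simp add: order_def card_D)
  then show ?thesis using D.pow_order_eq_1[of d] assms by (simp flip: nat_pow_consistent)
qed

text \<open>On the center \<open>\<tau>\<close> is the identity, so the norm relation becomes
  \<open>d\<close>^3 = 1, while the order of \<open>d\<close> also divides 25.\<close>

lemma D_Z:
  assumes "d \<in> D" "d \<in> Z"
  shows "d = \<one>"
proof -
  have dc: "d \<in> carrier G" using assms subgroup.mem_carrier[OF D_subgroup] by blast
  have "d \<otimes> d \<otimes> d = \<one>" using norm_D[OF assms(1)] assms(2) by (simp add: Z_iff)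
  then have "d [^] (3::nat) = \<one>" using dc by (simp add: numeral_3_eq_3)
  then have "ord d dvd 3" using dc pow_eq_id by blast
  moreover have "ord d dvd 25" using dc pow_eq_id pow_25[OF assms(1)] by blast
  ultimately have "ord d dvd gcd 3 25" by (rule gcd_greatest)
  then have "ord d = 1" by (simp add: gcd_non_0_nat)
  then show ?thesis using ord_eq_1 dc by blast
qed

lemma ex_order_5: obtains x where "x \<in> D" "ord x = 5"
proof -
  have "D \<noteq> {\<one>}" using card_D by auto
  then obtain y where y: "y \<in> D" "y \<noteq> \<one>" using subgroup.one_closed[OF D_subgroup] by blast
  have D_pow: "y [^] n \<in> D" for n :: nat
    using y by (induction n) (auto intro: subgroup.one_closed[OF D_subgroup] subgroup.m_closed[OF D_subgroup])
  have yc: "y \<in> carrier G" using y subgroup.mem_carrier[OF D_subgroup] by blast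
  \<comment> \<open>If the fifth power of \<open>y\<close> is nontrivial, it serves as
    \<open>x\<close>; otherwise \<open>y\<close> does.\<close>
  obtain x where x: "x \<in> D" "x \<noteq> \<one>" "x [^] (5::nat) = \<one>"
  proof (cases "y [^] (5::nat) = \<one>")
    case False
    have "(y [^] (5::nat)) [^] (5::nat) = \<one>" using pow_25[OF y(1)] yc by (simp add: nat_pow_pow)
    then show thesis using that False D_pow by blast
  qed (use that y in blast)
  then have xc: "x \<in> carrier G" using subgroup.mem_carrier[OF D_subgroup] by blast
  have "ord x dvd 5" using x xc pow_eq_id by blast
  moreover have "prime (5::nat)" by simp
  moreover have "ord x \<noteq> 1" using x xc ord_eq_1 by blast
  ultimately have "ord x = 5" by (metis prime_nat_iff)
  then show thesis using that x by blast
qed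

end

section \<open>Identification with the group of order 75\<close>

text \<open>This is the norm form of the Eisenstein integers, in which 5 is inert.\<close>

lemma five_dvd_norm_form:
  fixes a b :: int
  assumes "5 dvd a * a - a * b + b * b"
  shows "5 dvd a \<and> 5 dvd b"
proof -
  obtain p r where a: "a = 5 * p + r" and r: "r = a mod 5" by (metis mult_div_mod_eq)
  obtain q s where b: "b = 5 * q + s" and s: "s = b mod 5" by (metis mult_div_mod_eq)
  have "a * a - a * b + b * b
      = 5 * (5 * p * p + 2 * p * r - 5 * p * q - p * s - r * q + 5 * q * q + 2 * q * s) + (r * r - r * s + s * s)"
    unfolding a b by (simp add: algebra_simps)
  then have "5 dvd r * r - r * s + s * s" using assms by (metis dvd_add_right_iff dvd_triv_left)
  then have *: "(r * r - r * s + s * s) mod 5 = 0" by (simp add: dvd_eq_mod_eq_0)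
  have "r \<in> {0, 1, 2, 3, 4}" "s \<in> {0, 1, 2, 3, 4}" 
    unfolding r s insert_iff empty_iff by presburger+
  then have "r = 0 \<and> s = 0" using * by auto
  then show ?thesis using r s by (simp add: dvd_eq_mod_eq_0)
qed

locale abelian_index_3_generator = abelian_index_3 +
  fixes x :: 'a
  assumes x: "x \<in> D" and ord_x: "ord x = 5"
begin

text \<open>Coordinates on \<open>D\<close> in the basis \<open>x\<close>, \<open>\<tau> x\<close>.
  Exponents are arbitrary integers, so additivity holds exactly and reduction modulo 5 is kept apart
  in \<open>F_eq_iff\<close>.\<close>

definition F :: "int \<times> int \<Rightarrow> 'a" where
  "F v = x [^] fst v \<otimes> \<tau> x [^] snd v"

lemma D_carrier [simp]: "d \<in> D \<Longrightarrow> d \<in> carrier G"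
  using D_C by auto

lemma D_int_pow: "d \<in> D \<Longrightarrow> d [^] (n::int) \<in> D"
  using D_subgroup by (rule subgroup_int_pow_closed)

lemma x_in [simp]: "x \<in> carrier G" "\<tau> x \<in> D" "\<tau> x \<in> carrier G"
  using x \<tau>_D by auto

lemma F_D [simp]: "F v \<in> D"
  unfolding F_def using x by (intro subgroup.m_closed[OF D_subgroup] D_int_pow) auto

lemma F_C [simp]: "F v \<in> C"
  using F_D D_C by blast

lemma D_commute: "a \<in> D \<Longrightarrow> b \<in> D \<Longrightarrow> a \<otimes> b = b \<otimes> a"
  using D_C by (intro C_comm) auto

lemma F_add: "F (a + c, b + d) = F (a, b) \<otimes> F (c, d)"
proof -
  have "\<tau> x [^] b \<otimes> x [^] c = x [^] c \<otimes> \<tau> x [^] b" using x by (intro D_commute D_int_pow) auto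
  then have "x [^] a \<otimes> (\<tau> x [^] b \<otimes> x [^] c) \<otimes> \<tau> x [^] d
      = x [^] a \<otimes> (x [^] c \<otimes> \<tau> x [^] b) \<otimes> \<tau> x [^] d" by simp
  then show ?thesis by (simp add: F_def int_pow_mult m_assoc)
qed

lemma F_zero: "F (0, 0) = \<one>"
  by (simp add: F_def)

lemma \<tau>_int_pow: "d \<in> carrier G \<Longrightarrow> \<tau> (d [^] (n::int)) = \<tau> d [^] n"
proof -
  assume d: "d \<in> carrier G"
  have "\<tau> \<in> hom G G" using t by (auto simp: hom_def \<tau>_mult) (simp add: \<tau>_def)
  then interpret T: group_hom G G \<tau> by unfold_locales
  show ?thesis using T.hom_int_pow[OF d] by simp
qed

text \<open>By the norm relation \<open>\<tau> (\<tau> x)\<close> is the inverse of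
  \<open>x \<otimes> \<tau> x\<close>, so \<open>\<tau>\<close> acts by the companion matrix behind
  \<open>rot5\<close>.\<close>

lemma \<tau>_F: "\<tau> (F (a, b)) = F (- b, a - b)"
proof -
  have "x \<otimes> \<tau> x \<otimes> \<tau> (\<tau> x) = \<one>" using x by (rule norm_D)
  then have "inv (x \<otimes> \<tau> x) = \<tau> (\<tau> x)"
    using inv_equality[of "\<tau> (\<tau> x)" "x \<otimes> \<tau> x"] inv_comm \<tau>_D by simp
  moreover have "inv (x \<otimes> \<tau> x) [^] b = inv (x [^] b \<otimes> \<tau> x [^] b)"
    using int_pow_mult_distrib[OF D_commute[OF x x_in(2)]] by (simp add: int_pow_inv)
  ultimately have "\<tau> (F (a, b)) = \<tau> x [^] a \<otimes> inv (x [^] b \<otimes> \<tau> x [^] b)"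
    by (simp add: F_def \<tau>_mult \<tau>_int_pow)
  also have "\<dots> = (\<tau> x [^] a \<otimes> inv (\<tau> x [^] b)) \<otimes> inv (x [^] b)" by (simp add: word_simps)
  also have "\<dots> = inv (x [^] b) \<otimes> (\<tau> x [^] a \<otimes> inv (\<tau> x [^] b))"
    using x by (intro D_commute subgroup.m_closed[OF D_subgroup] subgroup.m_inv_closed[OF D_subgroup] D_int_pow) auto
  also have "\<dots> = F (- b, a - b)" by (simp add: F_def int_pow_neg int_pow_diff)
  finally show ?thesis .
qed

lemma x_pow_eq_one: "x [^] (n::int) = \<one> \<longleftrightarrow> 5 dvd n"
  using int_pow_eq_id[of x n] ord_x by simp

lemma F_eq_one: "F (a, b) = \<one> \<longleftrightarrow> 5 dvd a \<and> 5 dvd b"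
proof
  assume one: "F (a, b) = \<one>"
  have one': "F (- b, a - b) = \<one>" using \<tau>_F[of a b] one \<tau>_one by simp
  have pow: "F (n * c, n * d) = F (c, d) [^] n" for n c d
  proof -
    have "F (c, d) [^] n = (x [^] c) [^] n \<otimes> (\<tau> x [^] d) [^] n"
      unfolding F_def fst_conv snd_conv using x by (intro int_pow_mult_distrib D_commute D_int_pow) auto
    then show ?thesis by (simp add: F_def int_pow_pow mult.commute)
  qed
  \<comment> \<open>This multiplies a + b \<open>\<tau>\<close> by its conjugate (a - b) - b
    \<open>\<tau>\<close>. The second coordinate cancels and the first becomes the norm form, so
    independence of \<open>x\<close> and \<open>\<tau> x\<close> reduces to the order of
    \<open>x\<close>.\<close>
  have "F ((a - b) * a + (- b) * (- b), (a - b) * b + (- b) * (a - b)) = \<one>"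
    unfolding F_add pow one one' by simp
  also have "(a - b) * b + (- b) * (a - b) = 0" by (simp add: algebra_simps)
  also have "(a - b) * a + (- b) * (- b) = a * a - a * b + b * b" by (simp add: algebra_simps)
  finally have "x [^] (a * a - a * b + b * b) = \<one>" by (simp add: F_def)
  then show "5 dvd a \<and> 5 dvd b" using five_dvd_norm_form x_pow_eq_one by blast
next
  assume ab: "5 dvd a \<and> 5 dvd b"
  then have "x [^] a = \<one>" "x [^] b = \<one>" using x_pow_eq_one by auto
  moreover have "\<tau> x [^] b = \<tau> (x [^] b)" by (simp add: \<tau>_int_pow)
  ultimately show "F (a, b) = \<one>" by (simp add: F_def \<tau>_one)
qed

lemma F_eq_iff: "F (a, b) = F (c, d) \<longleftrightarrow> a mod 5 = c mod 5 \<and> b mod 5 = d mod 5"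
proof -
  have "F (a, b) = F (a - c, b - d) \<otimes> F (c, d)" using F_add[of "a - c" c "b - d" d] by simp
  then have "F (a, b) = F (c, d) \<longleftrightarrow> F (a - c, b - d) = \<one>"
    using r_cancel_one[of "F (c, d)" "F (a - c, b - d)"] by simp
  then show ?thesis by (simp add: F_eq_one mod_eq_dvd_iff)
qed

lemma F_inj: "inj_on F (carrier C5_C5)"
  by (rule inj_onI) (auto simp: carrier_C5_C5 F_eq_iff simp del: carrier_DirProd)

lemma F_mult: "F (v \<otimes>\<^bsub>C5_C5\<^esub> w) = F v \<otimes> F w"
proof -
  obtain a b c d where "v = (a, b)" "w = (c, d)" by (cases v, cases w) blast
  then show ?thesis by (simp add: F_add[symmetric] F_eq_iff)
qed

lemma F_rot5: "F (rot5 v) = \<tau> (F v)"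
  by (cases v) (simp add: rot5_def \<tau>_F F_eq_iff)

lemma F_rot5_pow: "F ((rot5 ^^ n) v) = t [^] n \<otimes> F v \<otimes> inv (t [^] n)"
proof (induction n)
  case (Suc n)
  have "t [^] Suc n = t \<otimes> t [^] n" using t by (intro nat_pow_Suc2)
  then show ?case using Suc t by (simp only: funpow.simps comp_apply F_rot5) (simp add: \<tau>_def word_simps)
qed simp

section \<open>Normal forms and the homomorphism onto the group of order 75\<close>

definition \<Phi> :: "(int \<times> int) \<times> int \<Rightarrow> 'a \<Rightarrow> 'a" where
  "\<Phi> p z = F (fst p) \<otimes> t [^] snd p \<otimes> z"

lemma carrier_G75: "carrier G75 = carrier C5_C5 \<times> {0..<3}"
  by (simp add: G75_def semidirect_product_def carrier_integer_mod_group)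

lemma Z_carrier: "z \<in> Z \<Longrightarrow> z \<in> carrier G"
  using Z_C by auto

lemma t_cube_pow: "t [^] (3 * n :: int) \<in> Z"
proof -
  have "t [^] (3::int) = t \<otimes> t \<otimes> t"
    using t int_pow_int[of G t 3] by (simp add: numeral_3_eq_3)
  then have "(t [^] (3::int)) [^] n \<in> Z" using t_cube by (simp add: subgroup_int_pow_closed[OF Z_subgroup])
  then show ?thesis using t by (simp add: int_pow_pow)
qed

text \<open>Powers of the cube of \<open>t\<close> are central, hence in \<open>C\<close>; dividing
  one off leaves the exponent 1 or -1.\<close>

lemma t_pow_C:
  assumes "t [^] (n::int) \<in> C" shows "3 dvd n"
proof (rule ccontr)
  assume n: "\<not> 3 dvd n"
  obtain m where "n = 3 * m + 1 \<or> n = 3 * m - 1"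
  proof -
    have "n = 3 * (n div 3) + 1 \<or> n = 3 * (n div 3 + 1) - 1" using n by presburger
    then show thesis using that by blast
  qed
  moreover have "t [^] (3 * m) \<in> C" using t_cube_pow Z_C by blast
  ultimately have "t [^] (n - 3 * m) \<in> C \<and> (n - 3 * m = 1 \<or> n - 3 * m = - 1)"
    using assms t by (auto simp: int_pow_diff)
  then have "t \<in> C" using t by (auto simp: int_pow_neg) (metis C_closed(3) inv_inv)
  with t show False by simp
qed

text \<open>Comparing modulo \<open>C\<close> gives equal exponents of \<open>t\<close>. Then the
  quotient of the two \<open>F\<close>-values lies in \<open>D\<close> and in the center, so it is
  trivial.\<close>

lemma \<Phi>_inj: "inj_on (\<lambda>(p, z). \<Phi> p z) (carrier G75 \<times> Z)"
proof (rule inj_onI, clarify)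
  fix a b i z c d j w
  assume p: "((a, b), i) \<in> carrier G75" "((c, d), j) \<in> carrier G75" and z: "z \<in> Z" "w \<in> Z"
    and eq: "\<Phi> ((a, b), i) z = \<Phi> ((c, d), j) w"
  note [simp] = Z_carrier[OF z(1)] Z_carrier[OF z(2)] t(1)
  have zC: "z \<in> C" "w \<in> C" using z Z_C by auto
  have eq': "F (a, b) \<otimes> z \<otimes> t [^] i = F (c, d) \<otimes> w \<otimes> t [^] j"
    using eq Z_commute[OF z(1), of "t [^] i"] Z_commute[OF z(2), of "t [^] j"] by (simp add: \<Phi>_def m_assoc)
  have "t [^] (i - j) = inv (F (a, b) \<otimes> z) \<otimes> (F (a, b) \<otimes> z \<otimes> t [^] i) \<otimes> inv (t [^] j)"
    by (simp add: int_pow_diff word_simps)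
  also have "\<dots> = inv (F (a, b) \<otimes> z) \<otimes> (F (c, d) \<otimes> w)"
    unfolding eq' by (simp add: word_simps)
  also have "\<dots> \<in> C" using zC by simp
  finally have "3 dvd i - j" by (rule t_pow_C)
  then have ij: "i = j" using p by (auto simp: carrier_G75 mod_eq_dvd_iff[symmetric] simp del: carrier_DirProd)
  then have e: "F (a, b) \<otimes> z = F (c, d) \<otimes> w" using eq' by simp
  have "inv (F (c, d)) \<otimes> F (a, b) = w \<otimes> inv z"
  proof -
    have "inv (F (c, d)) \<otimes> (F (a, b) \<otimes> z) \<otimes> inv z = inv (F (c, d)) \<otimes> (F (c, d) \<otimes> w) \<otimes> inv z"
      using e by simp
    then show ?thesis by (simp add: word_simps)
  qed
  moreover have "inv (F (c, d)) \<otimes> F (a, b) \<in> D"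
    by (intro subgroup.m_closed[OF D_subgroup] subgroup.m_inv_closed[OF D_subgroup]) auto
  moreover have "w \<otimes> inv z \<in> Z"
    using z by (intro subgroup.m_closed[OF Z_subgroup] subgroup.m_inv_closed[OF Z_subgroup])
  ultimately have "inv (F (c, d)) \<otimes> F (a, b) = \<one>" using D_Z by simp
  then have F: "F (a, b) = F (c, d)" by (simp add: inv_solve_left')
  moreover have "a = c \<and> b = d" using F p F_inj unfolding inj_on_def carrier_G75 by blast
  moreover have "z = w" using e F by simp
  ultimately show "(((a, b), i) = ((c, d), j)) \<and> z = w" using ij by simp
qed

text \<open>An injective image has \<open>75 * card Z\<close> elements, and this is the order of
  \<open>G\<close> because 75 = 3 x 25.\<close>

lemma \<Phi>_image: "(\<lambda>(p, z). \<Phi> p z) ` (carrier G75 \<times> Z) = carrier G"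
proof (rule card_subset_eq)
  show "(\<lambda>(p, z). \<Phi> p z) ` (carrier G75 \<times> Z) \<subseteq> carrier G"
    using t Z_carrier by (auto simp: \<Phi>_def)
  have "card ((\<lambda>(p, z). \<Phi> p z) ` (carrier G75 \<times> Z)) = 75 * card Z"
    using card_image[OF \<Phi>_inj] order_G75 by (simp add: card_cartesian_product order_def)
  then show "card ((\<lambda>(p, z). \<Phi> p z) ` (carrier G75 \<times> Z)) = card (carrier G)"
    using order_eq card_center by (simp add: order_def)
qed (rule fin)

text \<open>Since \<open>t\<^sup>3\<close> is central, forgetting the central factor of \<open>F v \<otimes> t [^] i \<otimes> z\<close> is a
  homomorphism; its kernel \<open>Z\<close> meets the derived subgroup trivially.\<close>

definition \<theta> :: "'a \<Rightarrow> (int \<times> int) \<times> int" where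
  "\<theta> g = (THE p. p \<in> carrier G75 \<and> (\<exists>z \<in> Z. g = \<Phi> p z))"

lemma \<theta>_\<Phi>:
  assumes "p \<in> carrier G75" "z \<in> Z"
  shows "\<theta> (\<Phi> p z) = p"
  unfolding \<theta>_def
proof (rule the_equality)
  fix q assume "q \<in> carrier G75 \<and> (\<exists>w \<in> Z. \<Phi> p z = \<Phi> q w)"
  then obtain w where "q \<in> carrier G75" "w \<in> Z" "\<Phi> p z = \<Phi> q w" by blast
  then show "q = p" using inj_onD[OF \<Phi>_inj, of "(p, z)" "(q, w)"] assms by simp
qed (use assms in blast)

lemma \<Phi>_cases:
  assumes "g \<in> carrier G"
  obtains p z where "p \<in> carrier G75" "z \<in> Z" "g = \<Phi> p z"
  using assms \<Phi>_image by force

text \<open>Moving \<open>t [^] i\<close> past \<open>F y\<close> applies the action of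
  \<open>G75\<close>. Reducing \<open>i + j\<close> modulo 3 leaves a carry, a power of the cube of
  \<open>t\<close>, which is central and is absorbed into \<open>u\<close>.\<close>

lemma \<Phi>_mult:
  assumes p: "p \<in> carrier G75" "q \<in> carrier G75" and z: "z \<in> Z" "w \<in> Z"
  shows "\<exists>u \<in> Z. \<Phi> p z \<otimes> \<Phi> q w = \<Phi> (p \<otimes>\<^bsub>G75\<^esub> q) u"
proof -
  obtain v i where vi: "p = (v, i)" "v \<in> carrier C5_C5" "0 \<le> i" using p by (auto simp: carrier_G75)
  obtain y j where yj: "q = (y, j)" "y \<in> carrier C5_C5" using p by (auto simp: carrier_G75)
  note [simp] = Z_carrier[OF z(1)] Z_carrier[OF z(2)] t(1)
  define k where "k = (i + j) mod 3"
  define s where "s = t [^] (3 * ((i + j) div 3))"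
  have sZ: "s \<in> Z" unfolding s_def by (rule t_cube_pow)
  note [simp] = Z_carrier[OF sZ]
  have ti: "t [^] nat i = t [^] i" using vi(3) by (rule pow_nat)
  have "F (C3_action i y) = t [^] i \<otimes> F y \<otimes> inv (t [^] i)"
    using yj F_rot5_pow[of "nat i" y] by (simp add: C3_action_def ti del: carrier_DirProd)
  then have Fa: "t [^] i \<otimes> F y = F (C3_action i y) \<otimes> t [^] i" by (simp add: word_simps)
  have "t [^] i \<otimes> t [^] j = t [^] (k + 3 * ((i + j) div 3))"
    by (simp add: k_def flip: int_pow_mult)
  then have ts: "t [^] i \<otimes> t [^] j = t [^] k \<otimes> s" by (simp add: int_pow_mult s_def)
  have "\<Phi> p z \<otimes> \<Phi> q w = F v \<otimes> t [^] i \<otimes> (z \<otimes> (F y \<otimes> t [^] j)) \<otimes> w"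
    by (simp add: \<Phi>_def vi yj m_assoc)
  also have "z \<otimes> (F y \<otimes> t [^] j) = F y \<otimes> t [^] j \<otimes> z" using z by (intro Z_commute) auto
  also have "F v \<otimes> t [^] i \<otimes> (F y \<otimes> t [^] j \<otimes> z) \<otimes> w = F v \<otimes> (t [^] i \<otimes> F y) \<otimes> t [^] j \<otimes> (z \<otimes> w)"
    by (simp add: m_assoc)
  also have "\<dots> = F v \<otimes> F (C3_action i y) \<otimes> (t [^] i \<otimes> t [^] j) \<otimes> (z \<otimes> w)"
    unfolding Fa by (simp add: m_assoc)
  also have "\<dots> = F (v \<otimes>\<^bsub>C5_C5\<^esub> C3_action i y) \<otimes> t [^] k \<otimes> (s \<otimes> z \<otimes> w)"
    unfolding ts F_mult by (simp add: m_assoc)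
  also have "\<dots> = \<Phi> (p \<otimes>\<^bsub>G75\<^esub> q) (s \<otimes> z \<otimes> w)"
    by (simp add: \<Phi>_def vi yj G75_def semidirect_product_def k_def)
  finally show ?thesis using sZ z subgroup.m_closed[OF Z_subgroup] by blast
qed

lemma isoclinic_G75: "isoclinic G G75"
proof (rule isoclinic_of_surj_hom)
  interpret G75: group G75 by (rule group_G75)
  show "group G75" by (rule group_G75)
  show "\<theta> \<in> hom G G75"
  proof (rule homI)
    fix g assume "g \<in> carrier G"
    then show "\<theta> g \<in> carrier G75" by (rule \<Phi>_cases) (simp add: \<theta>_\<Phi>)
  next
    fix g h assume "g \<in> carrier G" "h \<in> carrier G"
    then obtain p z q w where *: "p \<in> carrier G75" "z \<in> Z" "g = \<Phi> p z" "q \<in> carrier G75" "w \<in> Z" "h = \<Phi> q w"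
      by (metis \<Phi>_cases)
    then obtain u where "u \<in> Z" "g \<otimes> h = \<Phi> (p \<otimes>\<^bsub>G75\<^esub> q) u" using \<Phi>_mult by blast
    then show "\<theta> (g \<otimes> h) = \<theta> g \<otimes>\<^bsub>G75\<^esub> \<theta> h" using * by (simp add: \<theta>_\<Phi>)
  qed
  have \<Phi>_c: "\<Phi> p \<one> \<in> carrier G" for p using t by (simp add: \<Phi>_def)
  have one_Z: "\<one> \<in> Z" using Z_subgroup by (rule subgroup.one_closed)
  show "\<theta> ` carrier G = carrier G75"
  proof
    show "\<theta> ` carrier G \<subseteq> carrier G75" using \<Phi>_cases \<theta>_\<Phi> by (metis image_subsetI)
    show "carrier G75 \<subseteq> \<theta> ` carrier G"
    proof
      fix p assume "p \<in> carrier G75"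
      then have "p = \<theta> (\<Phi> p \<one>)" using one_Z by (simp add: \<theta>_\<Phi>)
      then show "p \<in> \<theta> ` carrier G" using \<Phi>_c by blast
    qed
  qed
  fix g assume g: "g \<in> derived G (carrier G)" "\<theta> g = \<one>\<^bsub>G75\<^esub>"
  then have gD: "g \<in> D" using derived_D by blast
  then obtain p z where *: "p \<in> carrier G75" "z \<in> Z" "g = \<Phi> p z" 
    using \<Phi>_cases[OF D_carrier] by metis
  then have "p = ((0, 0), 0)" using g(2) by (simp add: \<theta>_\<Phi> G75_def semidirect_product_def)
  then have "g = z" using * Z_carrier by (simp add: \<Phi>_def F_zero)
  then show "g = \<one>" using gD * D_Z by simp
qed (rule group_axioms)

end

section \<open>The second count and the conclusion\<close>

theorem theorem3:
  fixes G :: "('a, 'b) monoid_scheme"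
  assumes "group G"
    and "finite (carrier G)"
    and "odd (order G)"
    and "commuting_probability G > 35 / 243"
  shows "supersolvable G \<or> isoclinic G G75"
proof (rule disjCI)
  interpret odd_group G
    using assms by (simp add: odd_group_def odd_group_axioms_def finite_group_def finite_group_axioms_def)
  assume "\<not> isoclinic G G75"
  show "supersolvable G"
  proof (rule ccontr)
    assume "\<not> supersolvable G"
    then obtain C where C: "C \<lhd> G" "order G = 3 * card C"
      "\<And>x y. x \<in> C \<Longrightarrow> y \<in> C \<Longrightarrow> x \<otimes>\<^bsub>G\<^esub> y = y \<otimes>\<^bsub>G\<^esub> x"
      "\<And>x. x \<in> carrier G - C \<Longrightarrow> 25 * card (centralizer_in G C x) \<le> card C"
      using not_supersolvable_imp_abelian_index_3[OF assms(4)] by metis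
    have SC: "subgroup C G" using C(1) by (rule normal_imp_subgroup)
    have cC: "0 < card C" using card_subgroup_pos[OF SC] .
    have SZ: "subgroup (group_center G) G" using group_center_normal by (rule normal_imp_subgroup)
    \<comment> \<open>A central element outside \<open>C\<close> would centralize all of
      \<open>C\<close>, not just one 25th of it.\<close>
    have ZC: "group_center G \<subseteq> C"
    proof (rule ccontr)
      assume "\<not> group_center G \<subseteq> C"
      then obtain z where z: "z \<in> group_center G" "z \<in> carrier G - C" by (auto simp: group_center_def)
      then have "centralizer_in G C z = C"
        using subgroup.mem_carrier[OF SC] by (auto simp: centralizer_in_def group_center_def)
      with C(4)[OF z(2)] cC show False by simp
    qed
    \<comment> \<open>An element of the abelian group \<open>C\<close> that commutes with
      \<open>x\<close> is centralized by \<open>C\<close> and \<open>x\<close>, which generate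
      \<open>G\<close> as the index of \<open>C\<close> is 3.\<close>
    have cent: "centralizer_in G C x = group_center G" if x: "x \<in> carrier G - C" for x
    proof
      show "group_center G \<subseteq> centralizer_in G C x"
        using ZC x by (auto simp: centralizer_in_def group_center_def)
      show "centralizer_in G C x \<subseteq> group_center G"
      proof
        fix z assume z: "z \<in> centralizer_in G C x"
        then have zC: "z \<in> C" and zc: "z \<in> carrier G"
          using subgroup.mem_carrier[OF SC] by (auto simp: centralizer_in_def)
        let ?H = "centralizer_in G (carrier G) z"
        have H: "subgroup ?H G" using zc by (intro subgroup_centralizer_in subgroup_self)
        have "C \<subseteq> ?H" using C(3)[OF zC] subgroup.mem_carrier[OF SC] by (auto simp: centralizer_in_def)
        moreover have "x \<in> ?H" using z x by (auto simp: centralizer_in_def)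
        ultimately have "3 * card C \<le> card ?H" using x by (intro card_proper_subgroup SC H) auto
        then have "?H = carrier G" using C(2) cC by (intro subgroup_eq_carrier H) simp
        then show "z \<in> group_center G" using zc by (simp add: group_center_eq)
      qed
    qed
    obtain t where t: "t \<in> carrier G - C"
    proof -
      have "C \<noteq> carrier G" using C(2) cC by (auto simp: order_def)
      then show thesis using that subgroup.subset[OF SC] by blast
    qed
    obtain m where m: "card C = card (group_center G) * m"
      using card_subgroup_dvd[OF SZ SC ZC] by (auto elim: dvdE)
    have cZ: "0 < card (group_center G)" using card_subgroup_pos[OF SZ] .
    have "25 * card (group_center G) \<le> card C" using C(4)[OF t] cent[OF t] by simp
    then have m25: "25 \<le> m" using m cZ by simp
    have oddm: "odd m" using m odd_card_subgroup[OF SC] by simp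
    have cR: "card (rcosets\<^bsub>G\<^esub> C) = 3" using lagrange[OF SC] C(2) cC by simp
    interpret A: finite_group "G Mod C" using C(1) by (rule finite_group_quotient)
    interpret CC: finite_group "G\<lparr>carrier := C\<rparr>" using SC by (rule finite_group_subgroup)
    \<comment> \<open>The counting bound again, now with \<open>r\<close> the exact index
      \<open>m\<close> of the center in \<open>C\<close>. It yields 35/27 < 1 + 8/m, so
      \<open>m < 27\<close>, and oddness leaves 25.\<close>
    have "commuting_probability G * (real 3)\<^sup>2 \<le> commuting_probability (G\<lparr>carrier := C\<rparr>)
        + (commuting_probability (G Mod C) * (real 3)\<^sup>2 - 1) / real m"
      unfolding cR[symmetric] using cent m m25
      by (intro commuting_probability_quotient_bound C(1)) (auto simp: mult.commute)
    also have "\<dots> \<le> 1 + (1 * (real 3)\<^sup>2 - 1) / real m"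
      using A.commuting_probability_bounds(2) CC.commuting_probability_bounds(2)
      by (intro add_mono divide_right_mono diff_mono mult_right_mono) auto
    finally have "35 / 27 < 1 + 8 / real m" using assms(4) by simp
    then have "real m < 27" using m25 by (simp add: field_simps)
    then have "m = 25" using m25 oddm by (cases "m = 26") auto
    then have "abelian_index_3 G C t"
      by (intro abelian_index_3.intro abelian_index_3_axioms.intro odd_group_axioms)
        (use C t cent[OF t] m in auto)
    then interpret abelian_index_3 G C t .
    obtain x where "x \<in> D" "ord x = 5" by (rule ex_order_5)
    then interpret abelian_index_3_generator G C t x by unfold_locales
    show False using isoclinic_G75 \<open>\<not> isoclinic G G75\<close> by simp
  qed
qed

end
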